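(* Let $(\mathcal{C},X,Y,j,F)$ be a cartesian base: a cartesian category $\mathcal{C}$, classes $X$ and $Y$, and functions $j:X\to\mathrm{ob}(\mathcal{C})$ and $F:X\to Y$. Consider the following data. <br>- An object is a bimodule from $\mathcal{C}$ to $Y$. <br>- A loose-loose morphism $\mathcal{O}_0,\ldots,\mathcal{O}_{n-1}\to\Omega$ is a choice of functions $$\mathcal{O}_0(\Gamma\times jA_0,FA_1)\times\cdots\times\mathcal{O}_{n-1}(\Gamma\times jA_{n-1},FA_n)\to\Omega(\Gamma\times jA_0,FA_n)$$ natural in $\Gamma\in\mathcal{C}$, for all $A_0,\ldots,A_n\in X$. <br>- A tight-loose morphism $\lfloor\Phi,\mathcal{O}_0,\ldots,\mathcal{O}_{n-1}\to\Omega$ is a choice of functions $$\Phi(\Gamma,FA_0)\times\mathcal{O}_0(\Gamma\times jA_0,FA_1)\times\cdots\times\mathcal{O}_{n-1}(\Gamma\times jA_{n-1},FA_n)\to\Omega(\Gamma,FA_n)$$ natural in $\Gamma\in\mathcal{C}$, for all $A_0,\ldots,A_n\in X$. <br>- A loose-tight morphism $\mathcal{O}_0,\ldots,\mathcal{O}_{n-1},\Psi\rfloor\to\Omega$ is a choice of functions $$\mathcal{O}_0(\Gamma\times jA_0,FA_1)\times\cdots\times\mathcal{O}_{n-1}(\Gamma\times jA_{n-1},FA_n)\times\Psi(\Gamma\times jA_n,\underline{B})\to\Omega(\Gamma\times jA_0,\underline{B})$$ natural in $\Gamma\in\mathcal{C}$, for all $A_0,\ldots,A_n\in X$ and $\underline{B}\in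 Y$. <br>- A tight-tight morphism $\lfloor\Phi,\mathcal{O}_0,\ldots,\mathcal{O}_{n-1},\Psi\rfloor\to\Omega$ is a choice of functions $$\Phi(\Gamma,FA_0)\times\mathcal{O}_0(\Gamma\times jA_0,FA_1)\times\cdots\times\mathcal{O}_{n-1}(\Gamma\times jA_{n-1},FA_n)\times\Psi(\Gamma\times jA_n,\underline{B})\to\Omega(\Gamma,\underline{B})$$ natural in $\Gamma\in\mathcal{C}$, for all $A_0,\ldots,A_n\in X$ and $\underline{B}\in Y$. <br>- A tight-tight morphism $\lfloor\Phi\rfloor\to\Omega$ is a choice of functions $\Phi(\Gamma,\underline{B})\to\Omega(\Gamma,\underline{B})$ natural in $\Gamma\in\mathcal{C}$, for all $\underline{B}\in Y$. <br>- Left-loosening, right-loosening, composition and identities are the evident ones (written out in the context). <br>These form a (hyperlarge) bi-skew multicategory, and a RetSeq model on the cartesian base is precisely a monoid in it. That is, the assignment sending a RetSeq model $(\mathcal{O},\mathsf{ret},\mathsf{to})$ to $(\mathcal{O},m,e)$, where $m$ has components $\mathsf{to}^{\Gamma}_{A,\underline{B}}$ and $e$ has components $\mathsf{ret}^{\Gamma\times jA}_{A}(\pi'_{\Gamma,jA})\in\mathcal{O}(\Gamma\times jA,FA)$, is a bijection from RetSeq models to monoids in this bi-skew multicategory.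
   Context: **Conventions.** Composition is written in diagrammatic order. One distinguishes sets, classes and collections; a (light) category has a class of objects and hom-sets, and likewise for bi-skew multicategories; the "hyperlarge" version is obtained by replacing "class" and "set" by "collection". A cartesian category is a category with chosen finite products; $\pi_{x,y}:x\times y\to x$ and $\pi'_{x,y}:x\times y\to y$ are the projections, and we write $jA$ also for the identity on $jA$ (so $\sigma\times jA=\sigma\times\mathrm{id}_{jA}$). **Bimodule from a category to a class.** A bimodule $\mathcal{O}$ from $\mathcal{C}$ to the class $Y$ consists of sets $\mathcal{O}(\Gamma,\underline{B})$ for $\Gamma\in\mathcal{C}$, $\underline{B}\in Y$ (elements are called $\mathcal{O}$-morphisms $\Gamma\to\underline{B}$), with composites $\sigma;M\in\mathcal{O}(\Delta,\underline{B})$ for $\sigma:\Delta\to\Gamma$ in $\mathcal{C}$ and $M\in\mathcal{O}(\Gamma,\underline{B})$, satisfying $\mathrm{id};M=M$ and $(\tau;\sigma);M=\tau;(\sigma;M)$. "Natural in $\Gamma$" is with respect to this action; e.g. $\Gamma\mapsto\mathcal{O}(\Gamma\times jA,\underline{B})$ is acted on via $\sigma\times jA$. **RetSeq model.** On a cartesian base $(\mathcal{C},X,Y,j,F)$, a RetSeq model consists of a bimodule $\mathcal{O}$ from $\mathcal{C}$ to $Y$; for each $A\in X$, a function $\mathsf{ret}^{\Gamma}_A:\mathcal{C}(\Gamma,jA)\to\mathcal{O}(\Gamma,FA)$ natural in $\Gamma\in\mathcal{C}$; for each $A\in X$ and $\underline{B}\in Y$, a function $\mathsf{to}^{\Gamma}_{A,\underline{B}}:\mathcal{O}(\Gamma,FA)\times\mathcal{O}(\Gamma\times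 jA,\underline{B})\to\mathcal{O}(\Gamma,\underline{B})$ natural in $\Gamma\in\mathcal{C}$, written infix as $M\ \mathsf{to}\ N$; such that - $(\mathsf{ret}\,V)\ \mathsf{to}\ M=\langle\mathrm{id}_\Gamma,V\rangle;M$ for $V:\Gamma\to jA$ in $\mathcal{C}$ and $M\in\mathcal{O}(\Gamma\times jA,\underline{B})$; - $M\ \mathsf{to}\ (\mathsf{ret}\,\pi'_{\Gamma,jA})=M$ for $M\in\mathcal{O}(\Gamma,FA)$; - $(M\ \mathsf{to}\ N)\ \mathsf{to}\ P=M\ \mathsf{to}\ (N\ \mathsf{to}\ ((\pi_{\Gamma,jA}\times jB);P))$ for $M\in\mathcal{O}(\Gamma,FA)$, $N\in\mathcal{O}(\Gamma\times jA,FB)$, $P\in\mathcal{O}(\Gamma\times jB,\underline{C})$. **Bi-skew multicategory.** Consists of a class of objects; for every (possibly empty) object list $\vec a$ and object $x$ a set of loose-loose morphisms $\vec a\to x$; for every nonempty list $\vec a$ and object $x$ sets of tight-loose morphisms $\lfloor\vec a\to x$, loose-tight morphisms $\vec a\rfloor\to x$ and tight-tight morphisms $\lfloor\vec a\rfloor\to x$; a left-loosening operation $f\mapsto\acute f$ from tight-loose to loose-loose and from tight-tight to loose-tight morphisms; a right-loosening operation $f\mapsto\grave f$ from loose-tight to loose-loose and from tight-tight to tight-loose morphisms; for each object $x$ a tight-tight identity $\mathrm{id}_x:\lfloor x\rfloor\to x$; and compositions $g\circ_x f$ (at a specified occurrence of $x$) of the following forms: - (A) $g:\vec a,x,\vec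 c\to y$ and $f:\vec b\to x$, giving $\vec a,\vec b,\vec c\to y$; - (B) $g:\lfloor\vec a,x,\vec c\to y$ with $\vec a$ nonempty and $f:\vec b\to x$, giving $\lfloor\vec a,\vec b,\vec c\to y$; - (C) $g:\vec a,x,\vec c\rfloor\to y$ with $\vec c$ nonempty and $f:\vec b\to x$, giving $\vec a,\vec b,\vec c\rfloor\to y$; - (D) $g:\lfloor\vec a,x,\vec c\rfloor\to y$ with $\vec a,\vec c$ nonempty and $f:\vec b\to x$, giving $\lfloor\vec a,\vec b,\vec c\rfloor\to y$; - (E) $g:\lfloor x,\vec b\to y$ and $f:\lfloor\vec a\to x$, giving $\lfloor\vec a,\vec b\to y$; - (F) $g:\lfloor x,\vec b\rfloor\to y$ with $\vec b$ nonempty and $f:\lfloor\vec a\to x$, giving $\lfloor\vec a,\vec b\rfloor\to y$; - (G) $g:\vec a,x\rfloor\to y$ and $f:\vec b\rfloor\to x$, giving $\vec a,\vec b\rfloor\to y$; - (H) $g:\lfloor\vec a,x\rfloor\to y$ with $\vec a$ nonempty and $f:\vec b\rfloor\to x$, giving $\lfloor\vec a,\vec b\rfloor\to y$; - (I) $g:\lfloor x\rfloor\to y$ and $f:\lfloor\vec a\rfloor\to x$, giving $\lfloor\vec a\rfloor\to y$. Axioms: left- and right-loosening commute (write $\hat f$ for the result of applying both to a tight-tight $f$); left-loosening commutes with each composition form whose $g$ is left-tight, and right-loosening with each form whose $g$ is right-tight (the loosening of the composite is the composite of the loosened $g$ with $f$, where $f$ is loosened on the same side if it is tight on that side); composing an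 identity (loosened as needed) into any input of $g$ gives $g$; composing any $f$ into an identity (loosened as needed) gives $f$; associativity $h\circ_y(g\circ_x f)=(h\circ_y g)\circ_x f$ for all well-typed combinations of forms; interchange: composing two morphisms into two distinct inputs of $h$ gives the same result in either order, for all well-typed combinations. **Monoid in a bi-skew multicategory.** An object $x$ with a tight-tight $m:\lfloor x,x\rfloor\to x$ and a nullary loose-loose $e:\ \to x$ such that: composing $e$ into the first input of $\acute m$ gives $\acute{\mathrm{id}}_x$; composing $e$ into the second input of $\grave m$ gives $\grave{\mathrm{id}}_x$; composing $\grave m$ into the first input of $m$ (form F) equals composing $\acute m$ into the second input of $m$ (form H). **Structure of the bi-skew multicategory in the claim.** The left-loosening of $\varphi$ (tight-loose or tight-tight, with first input $\Phi$) has component at $\Gamma$ and $A,A_0,\ldots,A_n$ obtained from the component of $\varphi$ at $\Gamma\times jA$ and $A_0,\ldots,A_n$ by first precomposing every argument other than the first, lying in $\mathcal{O}_k(\Gamma\times jA_k,-)$ (or $\Psi(\Gamma\times jA_n,-)$), with $\pi_{\Gamma,jA}\times jA_k$ (resp. $\pi_{\Gamma,jA}\times jA_n$). Right-loosening restricts the family to those $\underline{B}$ of the form $FA$, $A\in X$. Identities are identity functions. Every composition form is given by substituting the value of the inner morphism as the relevant argument of the outer one, at matching $\Gamma$ and indices. *)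

theory Defs
  imports "HOL-Library.FuncSet"
begin

section \<open>Cartesian categories and cartesian bases\<close>

text \<open>Composition is diagrammatic: \<open>f ;; g\<close> is first \<open>f\<close>, then \<open>g\<close>.\<close>

record ('o, 'm) category =
  Ob :: "'o set"
  Arr :: "'m set"
  Dom :: "'m \<Rightarrow> 'o"
  Cod :: "'m \<Rightarrow> 'o"
  Id :: "'o \<Rightarrow> 'm"
  Cmp :: "'m \<Rightarrow> 'm \<Rightarrow> 'm" (infixr \<open>;;\<index>\<close> 65)
  One :: "'o"
  Prd :: "'o \<Rightarrow> 'o \<Rightarrow> 'o" (infixr \<open>\<otimes>\<index>\<close> 70)
  Pr1 :: "'o \<Rightarrow> 'o \<Rightarrow> 'm"
  Pr2 :: "'o \<Rightarrow> 'o \<Rightarrow> 'm"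

definition arrows :: "('o, 'm, 'z) category_scheme \<Rightarrow> 'o \<Rightarrow> 'o \<Rightarrow> 'm set" where
  "arrows C x y = {f \<in> Arr C. Dom C f = x \<and> Cod C f = y}"

definition pairing :: "('o, 'm, 'z) category_scheme \<Rightarrow> 'm \<Rightarrow> 'm \<Rightarrow> 'm" where
  "pairing C f g = (THE h. h \<in> arrows C (Dom C f) (Cod C f \<otimes>\<^bsub>C\<^esub> Cod C g) \<and>
     h ;;\<^bsub>C\<^esub> Pr1 C (Cod C f) (Cod C g) = f \<and> h ;;\<^bsub>C\<^esub> Pr2 C (Cod C f) (Cod C g) = g)"

definition prod_map :: "('o, 'm, 'z) category_scheme \<Rightarrow> 'm \<Rightarrow> 'm \<Rightarrow> 'm" where
  "prod_map C f g = pairing C (Pr1 C (Dom C f) (Dom C g) ;;\<^bsub>C\<^esub> f) (Pr2 C (Dom C f) (Dom C g) ;;\<^bsub>C\<^esub> g)"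

locale cartesian_category =
  fixes C :: "('o, 'm, 'z) category_scheme" (structure)
  assumes Dom_closed: "f \<in> Arr C \<Longrightarrow> Dom C f \<in> Ob C"
    and Cod_closed: "f \<in> Arr C \<Longrightarrow> Cod C f \<in> Ob C"
    and Id_arrows: "x \<in> Ob C \<Longrightarrow> Id C x \<in> arrows C x x"
    and Cmp_arrows: "\<lbrakk>f \<in> arrows C x y; g \<in> arrows C y z\<rbrakk> \<Longrightarrow> f ;; g \<in> arrows C x z"
    and Id_left: "f \<in> arrows C x y \<Longrightarrow> Id C x ;; f = f"
    and Id_right: "f \<in> arrows C x y \<Longrightarrow> f ;; Id C y = f"
    and Cmp_assoc: "\<lbrakk>f \<in> arrows C w x; g \<in> arrows C x y; h \<in> arrows C y z\<rbrakk>
      \<Longrightarrow> (f ;; g) ;; h = f ;; (g ;; h)"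
    and One_Ob: "One C \<in> Ob C"
    and One_terminal: "x \<in> Ob C \<Longrightarrow> \<exists>!f. f \<in> arrows C x (One C)"
    and Prd_Ob: "\<lbrakk>x \<in> Ob C; y \<in> Ob C\<rbrakk> \<Longrightarrow> x \<otimes> y \<in> Ob C"
    and Pr1_arrows: "\<lbrakk>x \<in> Ob C; y \<in> Ob C\<rbrakk> \<Longrightarrow> Pr1 C x y \<in> arrows C (x \<otimes> y) x"
    and Pr2_arrows: "\<lbrakk>x \<in> Ob C; y \<in> Ob C\<rbrakk> \<Longrightarrow> Pr2 C x y \<in> arrows C (x \<otimes> y) y"
    and Prd_universal: "\<lbrakk>f \<in> arrows C z x; g \<in> arrows C z y\<rbrakk>
      \<Longrightarrow> \<exists>!h. h \<in> arrows C z (x \<otimes> y) \<and> h ;; Pr1 C x y = f \<and> h ;; Pr2 C x y = g"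

record ('o, 'm, 'x, 'y) base = "('o, 'm) category" +
  XX :: "'x set"
  YY :: "'y set"
  jj :: "'x \<Rightarrow> 'o"
  FF :: "'x \<Rightarrow> 'y"

locale cartesian_base = cartesian_category K
  for K :: "('o, 'm, 'x, 'y, 'z) base_scheme" (structure) +
  assumes jj_closed: "jj K \<in> XX K \<rightarrow> Ob K"
    and FF_closed: "FF K \<in> XX K \<rightarrow> YY K"


section \<open>Bimodules and RetSeq models\<close>

text \<open>The type \<open>'e\<close> is an arbitrary universe from which the elements of bimodules are drawn.
  Here and below, operations defined on part of a type are required to be \<open>undefined\<close> elsewhere
  (and carriers to be empty off the index sets), so that HOL equality of the structures is
  equality of the mathematical structures.\<close>

record ('o, 'm, 'y, 'e) bimodule =
  car :: "'o \<Rightarrow> 'y \<Rightarrow> 'e set"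
  act :: "'y \<Rightarrow> 'm \<Rightarrow> 'e \<Rightarrow> 'e"

locale bimodule =
  fixes K :: "('o, 'm, 'x, 'y) base" (structure)
    and Q :: "('o, 'm, 'y, 'e) bimodule"
  assumes car_empty: "\<Gamma> \<notin> Ob K \<or> B \<notin> YY K \<Longrightarrow> car Q \<Gamma> B = {}"
    and act_undefined: "\<sigma> \<notin> Arr K \<or> M \<notin> car Q (Cod K \<sigma>) B \<Longrightarrow> act Q B \<sigma> M = undefined"
    and act_closed: "\<lbrakk>\<sigma> \<in> arrows K \<Delta> \<Gamma>; M \<in> car Q \<Gamma> B\<rbrakk> \<Longrightarrow> act Q B \<sigma> M \<in> car Q \<Delta> B"
    and act_Id: "M \<in> car Q \<Gamma> B \<Longrightarrow> act Q B (Id K \<Gamma>) M = M"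
    and act_Cmp: "\<lbrakk>\<tau> \<in> arrows K \<Theta> \<Delta>; \<sigma> \<in> arrows K \<Delta> \<Gamma>; M \<in> car Q \<Gamma> B\<rbrakk>
      \<Longrightarrow> act Q B (\<tau> ;; \<sigma>) M = act Q B \<tau> (act Q B \<sigma> M)"

locale retseq_model = bimodule K Q
  for K :: "('o, 'm, 'x, 'y) base" (structure)
    and Q :: "('o, 'm, 'y, 'e) bimodule" +
  fixes ret :: "'o \<Rightarrow> 'x \<Rightarrow> 'm \<Rightarrow> 'e"
    and seq :: "'o \<Rightarrow> 'x \<Rightarrow> 'y \<Rightarrow> 'e \<Rightarrow> 'e \<Rightarrow> 'e"
  assumes ret_closed: "\<lbrakk>A \<in> XX K; V \<in> arrows K \<Gamma> (jj K A)\<rbrakk> \<Longrightarrow> ret \<Gamma> A V \<in> car Q \<Gamma> (FF K A)"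
    and ret_undefined: "A \<notin> XX K \<or> V \<notin> arrows K \<Gamma> (jj K A) \<Longrightarrow> ret \<Gamma> A V = undefined"
    and ret_natural: "\<lbrakk>A \<in> XX K; \<sigma> \<in> arrows K \<Delta> \<Gamma>; V \<in> arrows K \<Gamma> (jj K A)\<rbrakk>
      \<Longrightarrow> ret \<Delta> A (\<sigma> ;; V) = act Q (FF K A) \<sigma> (ret \<Gamma> A V)"
    and seq_closed: "\<lbrakk>A \<in> XX K; B \<in> YY K; M \<in> car Q \<Gamma> (FF K A); N \<in> car Q (\<Gamma> \<otimes> jj K A) B\<rbrakk>
      \<Longrightarrow> seq \<Gamma> A B M N \<in> car Q \<Gamma> B"
    and seq_undefined:
      "A \<notin> XX K \<or> B \<notin> YY K \<or> M \<notin> car Q \<Gamma> (FF K A) \<or> N \<notin> car Q (\<Gamma> \<otimes> jj K A) B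
      \<Longrightarrow> seq \<Gamma> A B M N = undefined"
    and seq_natural:
      "\<lbrakk>A \<in> XX K; B \<in> YY K; \<sigma> \<in> arrows K \<Delta> \<Gamma>;
        M \<in> car Q \<Gamma> (FF K A); N \<in> car Q (\<Gamma> \<otimes> jj K A) B\<rbrakk>
      \<Longrightarrow> seq \<Delta> A B (act Q (FF K A) \<sigma> M) (act Q B (prod_map K \<sigma> (Id K (jj K A))) N)
        = act Q B \<sigma> (seq \<Gamma> A B M N)"
    and ret_seq:
      "\<lbrakk>A \<in> XX K; B \<in> YY K; V \<in> arrows K \<Gamma> (jj K A); M \<in> car Q (\<Gamma> \<otimes> jj K A) B\<rbrakk>
      \<Longrightarrow> seq \<Gamma> A B (ret \<Gamma> A V) M = act Q B (pairing K (Id K \<Gamma>) V) M"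
    and seq_ret:
      "\<lbrakk>A \<in> XX K; M \<in> car Q \<Gamma> (FF K A)\<rbrakk>
      \<Longrightarrow> seq \<Gamma> A (FF K A) M (ret (\<Gamma> \<otimes> jj K A) A (Pr2 K \<Gamma> (jj K A))) = M"
    and seq_seq:
      "\<lbrakk>A \<in> XX K; A' \<in> XX K; B \<in> YY K; M \<in> car Q \<Gamma> (FF K A);
        N \<in> car Q (\<Gamma> \<otimes> jj K A) (FF K A'); P \<in> car Q (\<Gamma> \<otimes> jj K A') B\<rbrakk>
      \<Longrightarrow> seq \<Gamma> A' B (seq \<Gamma> A (FF K A') M N) P
        = seq \<Gamma> A B M (seq (\<Gamma> \<otimes> jj K A) A' B N
            (act Q B (prod_map K (Pr1 K \<Gamma> (jj K A)) (Id K (jj K A'))) P))"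

definition retseq_models ::
  "('o, 'm, 'x, 'y) base \<Rightarrow>
    (('o, 'm, 'y, 'e) bimodule \<times> ('o \<Rightarrow> 'x \<Rightarrow> 'm \<Rightarrow> 'e) \<times> ('o \<Rightarrow> 'x \<Rightarrow> 'y \<Rightarrow> 'e \<Rightarrow> 'e \<Rightarrow> 'e)) set"
where
  "retseq_models K = {(Q, ret, seq). retseq_model K Q ret seq}"


section \<open>Bi-skew multicategories\<close>

datatype tightness = Loose | Tight

text \<open>\<open>Hom S l r as y\<close> is the set of morphisms \<open>as \<rightarrow> y\<close> whose left end has tightness \<open>l\<close> and whose
  right end has tightness \<open>r\<close>. Since hom-sets need not be disjoint, every operation is given
  the type of its arguments: \<open>LLoosen S r as y\<close> goes from \<open>Hom S Tight r as y\<close> to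
  \<open>Hom S Loose r as y\<close>, and \<open>RLoosen S l as y\<close> from \<open>Hom S l Tight as y\<close> to \<open>Hom S l Loose as y\<close>;
  \<open>Comp S l r as x cs y bs g f\<close> composes \<open>f : bs \<rightarrow> x\<close> into the input \<open>x\<close> of
  \<open>g : as, x, cs \<rightarrow> y\<close>, where \<open>l\<close> and \<open>r\<close> are the tightnesses of \<open>g\<close>.\<close>

record ('a, 'f) multicat =
  Objs :: "'a set"
  Hom :: "tightness \<Rightarrow> tightness \<Rightarrow> 'a list \<Rightarrow> 'a \<Rightarrow> 'f set"
  LLoosen :: "tightness \<Rightarrow> 'a list \<Rightarrow> 'a \<Rightarrow> 'f \<Rightarrow> 'f"
  RLoosen :: "tightness \<Rightarrow> 'a list \<Rightarrow> 'a \<Rightarrow> 'f \<Rightarrow> 'f"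
  Ident :: "'a \<Rightarrow> 'f"
  Comp :: "tightness \<Rightarrow> tightness \<Rightarrow> 'a list \<Rightarrow> 'a \<Rightarrow> 'a list \<Rightarrow> 'a \<Rightarrow> 'a list \<Rightarrow> 'f \<Rightarrow> 'f \<Rightarrow> 'f"

text \<open>Morphisms that are tight on some side exist only for nonempty input lists.\<close>

definition mor :: "('a, 'f) multicat \<Rightarrow> tightness \<Rightarrow> tightness \<Rightarrow> 'a list \<Rightarrow> 'a \<Rightarrow> 'f set" where
  "mor S l r as y = {f \<in> Hom S l r as y.
     set as \<subseteq> Objs S \<and> y \<in> Objs S \<and> (as = [] \<longrightarrow> l = Loose \<and> r = Loose)}"

text \<open>The identity on \<open>x\<close>, loosened as needed to have tightnesses \<open>l\<close> and \<open>r\<close>.\<close>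

fun ident_at :: "('a, 'f) multicat \<Rightarrow> tightness \<Rightarrow> tightness \<Rightarrow> 'a \<Rightarrow> 'f" where
  "ident_at S Tight Tight x = Ident S x"
| "ident_at S Loose Tight x = LLoosen S Tight [x] x (Ident S x)"
| "ident_at S Tight Loose x = RLoosen S Tight [x] x (Ident S x)"
| "ident_at S Loose Loose x = RLoosen S Loose [x] x (LLoosen S Tight [x] x (Ident S x))"

text \<open>In a composite of \<open>g : as, x, cs \<rightarrow> y\<close> with \<open>f : bs \<rightarrow> x\<close>, the morphism \<open>f\<close> must be left-tight
  if \<open>g\<close> is left-tight and \<open>as\<close> is empty, and left-loose otherwise; likewise on the right with \<open>cs\<close>.
  Thus, if \<open>g\<close> has tightnesses \<open>l\<close> and \<open>r\<close>, then \<open>f\<close> has tightnesses \<open>inner l as\<close> and \<open>inner r cs\<close>.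
  This yields exactly the nine forms of composition: one for loose-loose \<open>g\<close>; two for
  tight-loose \<open>g\<close> (\<open>as\<close> nonempty or empty) and two for loose-tight \<open>g\<close> (\<open>cs\<close> nonempty or empty);
  and four for tight-tight \<open>g\<close>.\<close>

definition inner :: "tightness \<Rightarrow> 'a list \<Rightarrow> tightness" where
  "inner t as = (if as = [] then t else Loose)"

locale bi_skew_multicategory =
  fixes S :: "('a, 'f) multicat"
  assumes LLoosen_mor: "f \<in> mor S Tight r as y \<Longrightarrow> LLoosen S r as y f \<in> mor S Loose r as y"
    and RLoosen_mor: "f \<in> mor S l Tight as y \<Longrightarrow> RLoosen S l as y f \<in> mor S l Loose as y"
    and Ident_mor: "x \<in> Objs S \<Longrightarrow> Ident S x \<in> mor S Tight Tight [x] x"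
    and Comp_mor:
      "\<lbrakk>g \<in> mor S l r (as @ x # cs) y; f \<in> mor S (inner l as) (inner r cs) bs x\<rbrakk>
      \<Longrightarrow> Comp S l r as x cs y bs g f \<in> mor S l r (as @ bs @ cs) y"
    and Loosen_commute: "f \<in> mor S Tight Tight as y
      \<Longrightarrow> RLoosen S Loose as y (LLoosen S Tight as y f) = LLoosen S Loose as y (RLoosen S Tight as y f)"
    and LLoosen_Comp:
      "\<lbrakk>g \<in> mor S Tight r (as @ x # cs) y; f \<in> mor S (inner Tight as) (inner r cs) bs x\<rbrakk>
      \<Longrightarrow> LLoosen S r (as @ bs @ cs) y (Comp S Tight r as x cs y bs g f)
        = Comp S Loose r as x cs y bs (LLoosen S r (as @ x # cs) y g)
            (if as = [] then LLoosen S (inner r cs) bs x f else f)"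
    and RLoosen_Comp:
      "\<lbrakk>g \<in> mor S l Tight (as @ x # cs) y; f \<in> mor S (inner l as) (inner Tight cs) bs x\<rbrakk>
      \<Longrightarrow> RLoosen S l (as @ bs @ cs) y (Comp S l Tight as x cs y bs g f)
        = Comp S l Loose as x cs y bs (RLoosen S l (as @ x # cs) y g)
            (if cs = [] then RLoosen S (inner l as) bs x f else f)"
    and Comp_Ident: "g \<in> mor S l r (as @ x # cs) y
      \<Longrightarrow> Comp S l r as x cs y [x] g (ident_at S (inner l as) (inner r cs) x) = g"
    and Ident_Comp: "f \<in> mor S l r bs x \<Longrightarrow> Comp S l r [] x [] x bs (ident_at S l r x) f = f"
    and Comp_assoc:
      "\<lbrakk>h \<in> mor S l r (as @ y # es) z;
        g \<in> mor S (inner l as) (inner r es) (bs @ x # ds) y;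
        f \<in> mor S (inner l (as @ bs)) (inner r (ds @ es)) cs x\<rbrakk>
      \<Longrightarrow> Comp S l r as y es z (bs @ cs @ ds) h
            (Comp S (inner l as) (inner r es) bs x ds y cs g f)
        = Comp S l r (as @ bs) x (ds @ es) z cs
            (Comp S l r as y es z (bs @ x # ds) h g) f"
    and Comp_interchange:
      "\<lbrakk>h \<in> mor S l r (as @ x # bs @ y # cs) z;
        f \<in> mor S (inner l as) Loose ds x;
        g \<in> mor S Loose (inner r cs) es y\<rbrakk>
      \<Longrightarrow> Comp S l r (as @ ds @ bs) y cs z es (Comp S l r as x (bs @ y # cs) z ds h f) g
        = Comp S l r as x (bs @ es @ cs) z ds (Comp S l r (as @ x # bs) y cs z es h g) f"

definition monoids :: "('a, 'f) multicat \<Rightarrow> ('a \<times> 'f \<times> 'f) set" where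
  "monoids S = {(x, m, e). x \<in> Objs S \<and> m \<in> mor S Tight Tight [x, x] x \<and> e \<in> mor S Loose Loose [] x \<and>
     Comp S Loose Tight [] x [x] x [] (LLoosen S Tight [x, x] x m) e = LLoosen S Tight [x] x (Ident S x) \<and>
     Comp S Tight Loose [x] x [] x [] (RLoosen S Tight [x, x] x m) e = RLoosen S Tight [x] x (Ident S x) \<and>
     Comp S Tight Tight [] x [x] x [x, x] m (RLoosen S Tight [x, x] x m) =
     Comp S Tight Tight [x] x [] x [x, x] m (LLoosen S Tight [x, x] x m)}"


section \<open>The bi-skew multicategory of bimodules\<close>

text \<open>The components of a morphism with \<open>k\<close> inputs \<open>Q\<^sub>0, \<dots>, Q\<^sub>k\<^sub>-\<^sub>1\<close> are indexed by \<open>\<Gamma>\<close> and a list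
  \<open>s\<^sub>0, \<dots>, s\<^sub>k\<close> of stages, as follows:
  \<^item> loose-loose: \<open>Mid A\<^sub>0, \<dots>, Mid A\<^sub>n\<close>
  \<^item> tight-loose: \<open>Start, Mid A\<^sub>0, \<dots>, Mid A\<^sub>n\<close>
  \<^item> loose-tight: \<open>Mid A\<^sub>0, \<dots>, Mid A\<^sub>n, End B\<close>
  \<^item> tight-tight: \<open>Start, Mid A\<^sub>0, \<dots>, Mid A\<^sub>n, End B\<close>, or \<open>Start, End B\<close> if there is only one input.

  The \<open>i\<close>th argument lies in \<open>Q\<^sub>i(ctx \<Gamma> s\<^sub>i, trg s\<^sub>i\<^sub>+\<^sub>1)\<close> and the result in
  \<open>\<Omega>(ctx \<Gamma> s\<^sub>0, trg s\<^sub>k)\<close>, where a stage \<open>Mid A\<close> gives the context \<open>\<Gamma> \<times> jA\<close> and the target \<open>FA\<close>,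
  \<open>Start\<close> gives the context \<open>\<Gamma>\<close>, and \<open>End B\<close> gives the target \<open>B\<close>. \<open>Start\<close> is never used as a target
  and \<open>End B\<close> never as a context.\<close>

datatype ('x, 'y) stage = Start | Mid 'x | End 'y

definition stages :: "('o, 'm, 'x, 'y) base \<Rightarrow> tightness \<Rightarrow> tightness \<Rightarrow> nat \<Rightarrow> ('x, 'y) stage list set" where
  "stages K l r k = {s @ map Mid As @ t | s As t.
     s \<in> (case l of Loose \<Rightarrow> {[]} | Tight \<Rightarrow> {[Start]}) \<and>
     set As \<subseteq> XX K \<and>
     t \<in> (case r of Loose \<Rightarrow> {[]} | Tight \<Rightarrow> {[End B] | B. B \<in> YY K}) \<and>
     length (s @ map Mid As @ t) = Suc k}"

fun ctx :: "('o, 'm, 'x, 'y) base \<Rightarrow> 'o \<Rightarrow> ('x, 'y) stage \<Rightarrow> 'o" where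
  "ctx K \<Gamma> Start = \<Gamma>"
| "ctx K \<Gamma> (Mid A) = \<Gamma> \<otimes>\<^bsub>K\<^esub> jj K A"
| "ctx K \<Gamma> (End B) = undefined"

fun ctx_map :: "('o, 'm, 'x, 'y) base \<Rightarrow> 'm \<Rightarrow> ('x, 'y) stage \<Rightarrow> 'm" where
  "ctx_map K \<sigma> Start = \<sigma>"
| "ctx_map K \<sigma> (Mid A) = prod_map K \<sigma> (Id K (jj K A))"
| "ctx_map K \<sigma> (End B) = undefined"

fun trg :: "('o, 'm, 'x, 'y) base \<Rightarrow> ('x, 'y) stage \<Rightarrow> 'y" where
  "trg K Start = undefined"
| "trg K (Mid A) = FF K A"
| "trg K (End B) = B"

type_synonym ('o, 'x, 'y, 'e) multimap = "'o \<Rightarrow> ('x, 'y) stage list \<Rightarrow> 'e list \<Rightarrow> 'e"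

definition multimap_dom :: "('o, 'm, 'x, 'y) base \<Rightarrow> tightness \<Rightarrow> tightness \<Rightarrow>
    ('o, 'm, 'y, 'e) bimodule list \<Rightarrow> ('o \<times> ('x, 'y) stage list \<times> 'e list) set" where
  "multimap_dom K l r Qs = {(\<Gamma>, ss, Ms). \<Gamma> \<in> Ob K \<and> ss \<in> stages K l r (length Qs) \<and>
     length Ms = length Qs \<and>
     (\<forall>i < length Qs. Ms ! i \<in> car (Qs ! i) (ctx K \<Gamma> (ss ! i)) (trg K (ss ! Suc i)))}"

text \<open>Precompose the \<open>i\<close>th argument with \<open>\<sigma>\<close> (at stage \<open>Start\<close>) or with \<open>\<sigma> \<times> jA\<close> (at stage \<open>Mid A\<close>).\<close>

definition act_args :: "('o, 'm, 'x, 'y) base \<Rightarrow> ('o, 'm, 'y, 'e) bimodule list \<Rightarrow> 'm \<Rightarrow>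
    ('x, 'y) stage list \<Rightarrow> 'e list \<Rightarrow> 'e list" where
  "act_args K Qs \<sigma> ss Ms =
     map (\<lambda>i. act (Qs ! i) (trg K (ss ! Suc i)) (ctx_map K \<sigma> (ss ! i)) (Ms ! i)) [0..<length Qs]"

definition multimaps :: "('o, 'm, 'x, 'y) base \<Rightarrow> tightness \<Rightarrow> tightness \<Rightarrow>
    ('o, 'm, 'y, 'e) bimodule list \<Rightarrow> ('o, 'm, 'y, 'e) bimodule \<Rightarrow> ('o, 'x, 'y, 'e) multimap set" where
  "multimaps K l r Qs \<Omega> = {\<phi>.
     (\<forall>\<Gamma> ss Ms. (\<Gamma>, ss, Ms) \<in> multimap_dom K l r Qs \<longrightarrow>
        \<phi> \<Gamma> ss Ms \<in> car \<Omega> (ctx K \<Gamma> (hd ss)) (trg K (last ss))) \<and>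
     (\<forall>\<Gamma> ss Ms. (\<Gamma>, ss, Ms) \<notin> multimap_dom K l r Qs \<longrightarrow> \<phi> \<Gamma> ss Ms = undefined) \<and>
     (\<forall>\<Delta> \<Gamma> \<sigma> ss Ms. \<sigma> \<in> arrows K \<Delta> \<Gamma> \<longrightarrow> (\<Gamma>, ss, Ms) \<in> multimap_dom K l r Qs \<longrightarrow>
        \<phi> \<Delta> ss (act_args K Qs \<sigma> ss Ms)
        = act \<Omega> (trg K (last ss)) (ctx_map K \<sigma> (hd ss)) (\<phi> \<Gamma> ss Ms))}"

definition mrestrict :: "('o, 'm, 'x, 'y) base \<Rightarrow> tightness \<Rightarrow> tightness \<Rightarrow>
    ('o, 'm, 'y, 'e) bimodule list \<Rightarrow> ('o, 'x, 'y, 'e) multimap \<Rightarrow> ('o, 'x, 'y, 'e) multimap" where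
  "mrestrict K l r Qs \<phi> =
     (\<lambda>\<Gamma> ss Ms. if (\<Gamma>, ss, Ms) \<in> multimap_dom K l r Qs then \<phi> \<Gamma> ss Ms else undefined)"

definition mloosen_left :: "('o, 'm, 'x, 'y) base \<Rightarrow> tightness \<Rightarrow>
    ('o, 'm, 'y, 'e) bimodule list \<Rightarrow> ('o, 'x, 'y, 'e) multimap \<Rightarrow> ('o, 'x, 'y, 'e) multimap" where
  "mloosen_left K r Qs \<phi> = mrestrict K Loose r Qs (\<lambda>\<Gamma> ss Ms.
     case hd ss of Mid A \<Rightarrow>
       \<phi> (\<Gamma> \<otimes>\<^bsub>K\<^esub> jj K A) (Start # tl ss)
         (hd Ms # act_args K (tl Qs) (Pr1 K \<Gamma> (jj K A)) (tl ss) (tl Ms)))"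

definition mloosen_right :: "('o, 'm, 'x, 'y) base \<Rightarrow> tightness \<Rightarrow>
    ('o, 'm, 'y, 'e) bimodule list \<Rightarrow> ('o, 'x, 'y, 'e) multimap \<Rightarrow> ('o, 'x, 'y, 'e) multimap" where
  "mloosen_right K l Qs \<phi> = mrestrict K l Loose Qs (\<lambda>\<Gamma> ss Ms.
     case last ss of Mid A \<Rightarrow> \<phi> \<Gamma> (butlast ss @ [End (FF K A)]) Ms)"

definition mident :: "('o, 'm, 'x, 'y) base \<Rightarrow> ('o, 'm, 'y, 'e) bimodule \<Rightarrow> ('o, 'x, 'y, 'e) multimap" where
  "mident K Q = mrestrict K Tight Tight [Q] (\<lambda>\<Gamma> ss Ms. hd Ms)"

text \<open>With \<open>p\<close> inputs before the one substituted for and \<open>q\<close> inputs of \<open>f\<close>, the inner morphism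
  uses the stages \<open>s\<^sub>p, \<dots>, s\<^sub>p\<^sub>+\<^sub>q\<close> and the outer one \<open>s\<^sub>0, \<dots>, s\<^sub>p, s\<^sub>p\<^sub>+\<^sub>q, \<dots>\<close>; for \<open>q = 0\<close> the
  stage \<open>s\<^sub>p\<close> is thus repeated.\<close>

definition mcomp :: "('o, 'm, 'x, 'y) base \<Rightarrow> tightness \<Rightarrow> tightness \<Rightarrow>
    ('o, 'm, 'y, 'e) bimodule list \<Rightarrow> ('o, 'm, 'y, 'e) bimodule list \<Rightarrow> ('o, 'm, 'y, 'e) bimodule list \<Rightarrow>
    ('o, 'x, 'y, 'e) multimap \<Rightarrow> ('o, 'x, 'y, 'e) multimap \<Rightarrow> ('o, 'x, 'y, 'e) multimap" where
  "mcomp K l r as bs cs g f = mrestrict K l r (as @ bs @ cs) (\<lambda>\<Gamma> ss Ms.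
     let p = length as; q = length bs in
       g \<Gamma> (take (Suc p) ss @ drop (p + q) ss)
         (take p Ms @ f \<Gamma> (take (Suc q) (drop p ss)) (take q (drop p Ms)) # drop (p + q) Ms))"

definition bimod_multicat ::
  "('o, 'm, 'x, 'y) base \<Rightarrow> (('o, 'm, 'y, 'e) bimodule, ('o, 'x, 'y, 'e) multimap) multicat" where
  "bimod_multicat K =
    \<lparr> Objs = {Q. bimodule K Q},
      Hom = multimaps K,
      LLoosen = (\<lambda>r Qs \<Omega>. mloosen_left K r Qs),
      RLoosen = (\<lambda>l Qs \<Omega>. mloosen_right K l Qs),
      Ident = mident K,
      Comp = (\<lambda>l r as x cs y bs. mcomp K l r as bs cs) \<rparr>"


section \<open>From RetSeq models to monoids\<close>

definition retseq_mult :: "('o, 'm, 'x, 'y) base \<Rightarrow> ('o, 'm, 'y, 'e) bimodule \<Rightarrow>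
    ('o \<Rightarrow> 'x \<Rightarrow> 'y \<Rightarrow> 'e \<Rightarrow> 'e \<Rightarrow> 'e) \<Rightarrow> ('o, 'x, 'y, 'e) multimap" where
  "retseq_mult K Q seq = mrestrict K Tight Tight [Q, Q] (\<lambda>\<Gamma> ss Ms.
     case (ss, Ms) of ([Start, Mid A, End B], [M, N]) \<Rightarrow> seq \<Gamma> A B M N)"

definition retseq_unit :: "('o, 'm, 'x, 'y) base \<Rightarrow> ('o, 'm, 'y, 'e) bimodule \<Rightarrow>
    ('o \<Rightarrow> 'x \<Rightarrow> 'm \<Rightarrow> 'e) \<Rightarrow> ('o, 'x, 'y, 'e) multimap" where
  "retseq_unit K Q ret = mrestrict K Loose Loose [] (\<lambda>\<Gamma> ss Ms.
     case ss of [Mid A] \<Rightarrow> ret (\<Gamma> \<otimes>\<^bsub>K\<^esub> jj K A) A (Pr2 K \<Gamma> (jj K A)))"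

definition retseq_to_monoid ::
  "('o, 'm, 'x, 'y) base \<Rightarrow>
    ('o, 'm, 'y, 'e) bimodule \<times> ('o \<Rightarrow> 'x \<Rightarrow> 'm \<Rightarrow> 'e) \<times> ('o \<Rightarrow> 'x \<Rightarrow> 'y \<Rightarrow> 'e \<Rightarrow> 'e \<Rightarrow> 'e) \<Rightarrow>
    ('o, 'm, 'y, 'e) bimodule \<times> ('o, 'x, 'y, 'e) multimap \<times> ('o, 'x, 'y, 'e) multimap" where
  "retseq_to_monoid K = (\<lambda>(Q, ret, seq). (Q, retseq_mult K Q seq, retseq_unit K Q ret))"

end

theory Submission
  imports Defs
begin

text \<open>
  A component of a multimap is indexed by a list of stages, and composition cuts a segment out of
  this list. Each axiom of a bi-skew multicategory therefore reduces to an identity between lists of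
  stages and arguments, except that the compatibility of left-loosening with composition also uses
  the naturality of the inner morphism along the projection \<open>\<Gamma> \<times> jA \<rightarrow> \<Gamma>\<close>.

  A monoid with unit \<open>e\<close> determines its return operation, since naturality forces
  \<open>ret V = \<langle>id, V\<rangle>; ret \<pi>' = \<langle>id, V\<rangle>; e\<close>. The law \<open>(ret V) to M = \<langle>id, V\<rangle>; M\<close> at the generic
  element \<open>V = \<pi>'\<close> is the left unit law, and it follows in general by pulling the left unit law back
  along \<open>\<langle>id, V\<rangle>\<close>. The remaining laws correspond directly.
\<close>

section \<open>Cutting and grafting lists\<close>

text \<open>All nine composition forms are treated at once: \<open>inner\<close> computes the
  tightness of the substituted morphism, and one cut of the stage list serves every form. The
  obstacle is the nullary inner morphism, where the cut repeats a stage. A repeated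
  \<open>Start\<close> or \<open>End B\<close> would index nothing; it is excluded because a nullary
  morphism is loose on both sides, hence the side condition on an empty input list that recurs in
  the typing lemmas. Equality of morphisms is equality of HOL functions, so every composite is
  restricted to its index set, and a nested composite can be unfolded only after its arguments are
  shown to be indices. On the monoid side, \<open>e\<close> at \<Gamma> is an element over
  \<open>\<Gamma> \<times> jA\<close>, and its naturality concerns only the maps
  \<open>\<sigma> \<times> jA\<close>. The instance at the projection \<pi> makes \<open>e\<close>
  at \<open>\<Gamma> \<times> jA\<close> the weakening of \<open>e\<close> at \<Gamma>, and
  \<open>\<langle>id, \<pi>'\<rangle>; (\<pi> \<times> jA) = id\<close> undoes the weakening. This
  cancellation gives the right unit law of the model, the left unit law of the monoid and one of the
  round trips.\<close>

text \<open>For \<open>q = 0\<close>, \<open>skip p q\<close> repeats the entry at \<open>p\<close> (cf. \<open>mcomp\<close>).\<close>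

definition skip :: "nat \<Rightarrow> nat \<Rightarrow> 'a list \<Rightarrow> 'a list" where
  "skip p q xs = take (Suc p) xs @ drop (p + q) xs"

text \<open>Serves both kinds of list: \<open>seg p q\<close> cuts out \<open>q\<close> arguments,
  \<open>seg p (Suc q)\<close> the stages that bound them.\<close>

definition seg :: "nat \<Rightarrow> nat \<Rightarrow> 'a list \<Rightarrow> 'a list" where
  "seg p q xs = take q (drop p xs)"

text \<open>Acts on arguments only. The matching cut of stages is \<open>skip\<close>, which keeps
  the stages that bound the replaced segment.\<close>

definition graft :: "nat \<Rightarrow> nat \<Rightarrow> 'a \<Rightarrow> 'a list \<Rightarrow> 'a list" where
  "graft p q v xs = take p xs @ v # drop (p + q) xs"

lemma length_skip [simp]: "p + q < length xs \<Longrightarrow> length (skip p q xs) = Suc (length xs) - q"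
  by (auto simp: skip_def)

text \<open>Beyond \<open>p\<close> the index moves by \<open>q - 1\<close>. The form
  \<open>i + q - 1\<close> keeps the subtraction exact for \<open>q = 0\<close>, where positions
  \<open>i > p\<close> move back by one and entry \<open>p\<close> occurs twice.\<close>

lemma nth_skip: "p + q < length xs \<Longrightarrow> i < Suc (length xs) - q \<Longrightarrow>
  skip p q xs ! i = xs ! (if i \<le> p then i else i + q - 1)"
  by (auto simp: skip_def nth_append add.commute)

lemma length_seg [simp]: "p + q \<le> length xs \<Longrightarrow> length (seg p q xs) = q"
  by (auto simp: seg_def)

lemma nth_seg [simp]: "p + q \<le> length xs \<Longrightarrow> i < q \<Longrightarrow> seg p q xs ! i = xs ! (p + i)"
  by (auto simp: seg_def)

lemma length_graft [simp]: "p + q \<le> length xs \<Longrightarrow> length (graft p q v xs) = Suc (length xs) - q"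
  by (auto simp: graft_def)

lemma nth_graft: "p + q \<le> length xs \<Longrightarrow> i < Suc (length xs) - q \<Longrightarrow>
  graft p q v xs ! i = (if i < p then xs ! i else if i = p then v else xs ! (i + q - 1))"
  by (auto simp: graft_def nth_append nth_Cons' add.commute)

lemma hd_skip: "xs \<noteq> [] \<Longrightarrow> hd (skip p q xs) = hd xs"
  by (cases xs) (auto simp: skip_def)

lemma last_skip: "p + q < length xs \<Longrightarrow> last (skip p q xs) = last xs"
  by (auto simp: skip_def last_append)

lemma hd_seg: "p < length xs \<Longrightarrow> hd (seg p (Suc q) xs) = xs ! p"
  by (simp add: seg_def hd_drop_conv_nth)

lemma last_seg: "p + q < length xs \<Longrightarrow> last (seg p (Suc q) xs) = xs ! (p + q)"
  by (subst last_conv_nth) (auto simp: seg_def)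

lemma skip_Cons [simp]: "skip (Suc p) q (x # xs) = x # skip p q xs"
  "0 < q \<Longrightarrow> skip 0 q (x # xs) = x # drop (q - 1) xs"
  by (cases q; simp add: skip_def)+

lemma graft_Cons [simp]: "graft (Suc p) q v (x # xs) = x # graft p q v xs"
  "graft 0 q v xs = v # drop q xs"
  by (simp_all add: graft_def)

lemma seg_Cons [simp]: "seg (Suc p) q (x # xs) = seg p q xs"
  "seg 0 (Suc q) (x # xs) = x # take q xs"
  by (simp_all add: seg_def)

lemma skip_snoc:
  "p + q < length xs \<Longrightarrow> skip p q (xs @ [x]) = skip p q xs @ [x]"
  "p + q = length xs \<Longrightarrow> 0 < q \<Longrightarrow> skip p q (xs @ [x]) = take (Suc p) xs @ [x]"
  by (simp_all add: skip_def)

lemma seg_snoc: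
  "p + q \<le> length xs \<Longrightarrow> seg p q (xs @ [x]) = seg p q xs"
  "p + q = length xs \<Longrightarrow> seg p (Suc q) (xs @ [x]) = drop p xs @ [x]"
  by (simp_all add: seg_def)

section \<open>Nested cuts, for associativity\<close>

lemma seg_seg: "p + q \<le> n \<Longrightarrow> seg p q (seg m n xs) = seg (m + p) q xs"
  by (simp add: seg_def take_drop drop_drop take_take min_def add.commute)

text \<open>Here \<open>a\<close> and \<open>b\<close> count the inputs before the hole in the outer
  and in the middle morphism, \<open>d\<close> those after it in the middle one, and
  \<open>c\<close> is the arity of the innermost. The middle morphism has \<open>b + d + 1\<close>
  inputs before the substitution and \<open>b + c + d\<close> after it.\<close>

lemma skip_skip:
  "a + b + c + d < length xs \<Longrightarrow> skip a (Suc (b + d)) (skip (a + b) c xs) = skip a (b + c + d) xs"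
  by (rule nth_equalityI) (auto simp: nth_skip add_ac)

lemma seg_skip:
  "a + b + c + d < length xs \<Longrightarrow>
    seg a (Suc (Suc (b + d))) (skip (a + b) c xs) = skip b c (seg a (Suc (b + c + d)) xs)"
  by (rule nth_equalityI) (auto simp: nth_skip add_ac)

lemma seg_graft:
  "a + b + c + d \<le> length xs \<Longrightarrow>
    seg a (Suc (b + d)) (graft (a + b) c v xs) = graft b c v (seg a (b + c + d) xs)"
  by (rule nth_equalityI) (auto simp: nth_graft add_ac)

text \<open>The entry \<open>v\<close> lies in the segment that \<open>w\<close> replaces; in the
  application it survives only inside \<open>w\<close>, the value of the middle morphism.\<close>

lemma graft_graft:
  "a + b + c + d \<le> length xs \<Longrightarrow>
    graft a (Suc (b + d)) w (graft (a + b) c v xs) = graft a (b + c + d) w xs"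
  by (rule nth_equalityI) (auto simp: nth_graft add_ac)

section \<open>Disjoint cuts, for interchange\<close>

lemma skip_commute:
  "a + d + b + e < length xs \<Longrightarrow>
    skip a d (skip (a + d + b) e xs) = skip (Suc (a + b)) e (skip a d xs)"
  by (rule nth_equalityI) (auto simp: nth_skip add_ac)

lemma seg_skip_before:
  "a + d + b + e < length xs \<Longrightarrow> seg a (Suc d) (skip (a + d + b) e xs) = seg a (Suc d) xs"
  by (rule nth_equalityI) (auto simp: nth_skip add_ac)

text \<open>The \<open>d\<close> earlier inputs have been contracted to a single one, which moves
  the second hole from \<open>a + d + b\<close> to \<open>Suc (a + b)\<close>. The first hole is not
  moved by a cut to its right.\<close>

lemma seg_skip_after:
  "a + d + b + e < length xs \<Longrightarrow> seg (Suc (a + b)) (Suc e) (skip a d xs) = seg (a + d + b) (Suc e) xs"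
  by (rule nth_equalityI) (auto simp: nth_skip add_ac)

lemma seg_graft_before:
  "a + d + b + e \<le> length xs \<Longrightarrow> seg a d (graft (a + d + b) e v xs) = seg a d xs"
  by (rule nth_equalityI) (auto simp: nth_graft add_ac)

lemma seg_graft_after:
  "a + d + b + e \<le> length xs \<Longrightarrow> seg (Suc (a + b)) e (graft a d v xs) = seg (a + d + b) e xs"
  by (rule nth_equalityI) (auto simp: nth_graft add_ac)

lemma graft_commute:
  "a + d + b + e \<le> length xs \<Longrightarrow>
    graft a d v (graft (a + d + b) e w xs) = graft (Suc (a + b)) e w (graft a d v xs)"
  by (rule nth_equalityI) (auto simp: nth_graft add_ac)

section \<open>Stages and indices of multimaps\<close>

text \<open>Membership in \<open>stages\<close>, position by position: cuts renumber positions, and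
  a condition on each position passes through them without rebuilding the decomposition into
  \<open>s\<close>, \<open>As\<close> and \<open>t\<close>.\<close>

fun stage_at :: "('o, 'm, 'x, 'y) base \<Rightarrow> tightness \<Rightarrow> tightness \<Rightarrow> nat \<Rightarrow> nat \<Rightarrow> ('x, 'y) stage \<Rightarrow> bool" where
  "stage_at K l r k i Start \<longleftrightarrow> l = Tight \<and> i = 0"
| "stage_at K l r k i (Mid A) \<longleftrightarrow> \<not> (l = Tight \<and> i = 0) \<and> \<not> (r = Tight \<and> i = k) \<and> A \<in> XX K"
| "stage_at K l r k i (End B) \<longleftrightarrow> \<not> (l = Tight \<and> i = 0) \<and> r = Tight \<and> i = k \<and> B \<in> YY K"

lemma stage_at_Mid:
  "stage_at K l r k i s \<Longrightarrow> \<not> (l = Tight \<and> i = 0) \<Longrightarrow> \<not> (r = Tight \<and> i = k) \<Longrightarrow> \<exists>A\<in>XX K. s = Mid A"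
  by (cases s) auto

lemma map_Mid_ex:
  assumes "\<And>s. s \<in> set xs \<Longrightarrow> \<exists>A\<in>XX K. s = Mid A"
  shows "\<exists>As. xs = map Mid As \<and> set As \<subseteq> XX K"
  using assms by (induction xs) (auto, metis list.simps(9) list.set(2) insert_subset)

text \<open>For \<open>k = 0\<close> there are degenerate lists \<open>[Start]\<close> and \<open>[End B]\<close>; they index no morphisms.\<close>

lemma stages_iff:
  assumes "k = 0 \<longrightarrow> l = Loose \<and> r = Loose"
  shows "ss \<in> stages K l r k \<longleftrightarrow> length ss = Suc k \<and> (\<forall>i\<le>k. stage_at K l r k i (ss ! i))"
proof
  assume "ss \<in> stages K l r k"
  then obtain s As t where ss: "ss = s @ map Mid As @ t" and As: "set As \<subseteq> XX K"
    and s: "s \<in> (case l of Loose \<Rightarrow> {[]} | Tight \<Rightarrow> {[Start]})"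
    and t: "t \<in> (case r of Loose \<Rightarrow> {[]} | Tight \<Rightarrow> {[End B] | B. B \<in> YY K})"
    and len: "length ss = Suc k"
    unfolding stages_def by blast
  have "As ! i \<in> XX K" if "i < length As" for i using As that nth_mem by blast
  then show "length ss = Suc k \<and> (\<forall>i\<le>k. stage_at K l r k i (ss ! i))"
    using s t len assms by (cases l; cases r) (auto simp: ss nth_append nth_Cons')
next
  assume R: "length ss = Suc k \<and> (\<forall>i\<le>k. stage_at K l r k i (ss ! i))"
  have st: "stage_at K l r k i (ss ! i)" if "i \<le> k" for i using R that by blast
  \<comment> \<open>The \<open>Mid\<close> stages occupy the positions from \<open>a\<close> up to
    but excluding \<open>b\<close>.\<close>
  define a where "a = (if l = Tight then 1 else 0 :: nat)"
  define b where "b = (if r = Tight then k else Suc k)"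
  \<comment> \<open>The assumption on \<open>k = 0\<close> enters here: with no input and two tight
    ends, \<open>a\<close> would exceed \<open>b\<close>.\<close>
  have ab: "a \<le> b" "b \<le> Suc k" using assms by (cases l; cases r; simp add: a_def b_def; linarith)+
  have "\<exists>A\<in>XX K. s = Mid A" if s: "s \<in> set (take (b - a) (drop a ss))" for s
  proof -
    obtain i where "i < b - a" "s = ss ! (a + i)"
      using s R by (auto simp: in_set_conv_nth)
    moreover have "stage_at K l r k (a + i) (ss ! (a + i))"
      using \<open>i < b - a\<close> ab by (intro st) linarith
    moreover have "\<not> (l = Tight \<and> a + i = 0)" by (simp add: a_def)
    moreover have "\<not> (r = Tight \<and> a + i = k)" using \<open>i < b - a\<close> by (auto simp: b_def)
    ultimately show ?thesis using stage_at_Mid by metis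
  qed
  then obtain As where As: "take (b - a) (drop a ss) = map Mid As" "set As \<subseteq> XX K"
    using map_Mid_ex by metis
  have ss: "ss = take a ss @ map Mid As @ drop b ss"
    using ab As(1) by (metis append_take_drop_id drop_drop le_add_diff_inverse2)
  have s: "take a ss \<in> (case l of Loose \<Rightarrow> {[]} | Tight \<Rightarrow> {[Start]})"
  proof (cases l)
    case Tight
    then have "ss ! 0 = Start" using st[of 0] assms by (cases "ss ! 0") auto
    then show ?thesis using Tight R by (cases ss) (auto simp: a_def)
  qed (simp add: a_def)
  have t: "drop b ss \<in> (case r of Loose \<Rightarrow> {[]} | Tight \<Rightarrow> {[End B] | B. B \<in> YY K})"
  proof (cases r)
    case Tight
    then obtain B where "ss ! k = End B" "B \<in> YY K" using st[of k] assms by (cases "ss ! k") auto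
    moreover have "drop k ss = [ss ! k]" using R by (metis Cons_nth_drop_Suc drop_all lessI order_refl)
    ultimately show ?thesis using Tight by (auto simp: b_def)
  qed (use R in \<open>simp add: b_def\<close>)
  show "ss \<in> stages K l r k"
    unfolding stages_def
  proof (intro CollectI exI conjI)
    show "length (take a ss @ map Mid As @ drop b ss) = Suc k" using R ss by metis
  qed (fact ss s As(2) t)+
qed

lemma multimap_dom_iff:
  assumes "Qs = [] \<longrightarrow> l = Loose \<and> r = Loose"
  shows "(\<Gamma>, ss, Ms) \<in> multimap_dom K l r Qs \<longleftrightarrow>
    \<Gamma> \<in> Ob K \<and> length ss = Suc (length Qs) \<and> (\<forall>i\<le>length Qs. stage_at K l r (length Qs) i (ss ! i)) \<and>
    length Ms = length Qs \<and>
    (\<forall>i<length Qs. Ms ! i \<in> car (Qs ! i) (ctx K \<Gamma> (ss ! i)) (trg K (ss ! Suc i)))"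
  using assms by (auto simp: multimap_dom_def stages_iff)

lemma multimap_dom_length:
  "(\<Gamma>, ss, Ms) \<in> multimap_dom K l r Qs \<Longrightarrow> length ss = Suc (length Qs)"
  "(\<Gamma>, ss, Ms) \<in> multimap_dom K l r Qs \<Longrightarrow> length Ms = length Qs"
  by (auto simp: multimap_dom_def stages_def)

lemma mrestrict_dom [simp]:
  "(\<Gamma>, ss, Ms) \<in> multimap_dom K l r Qs \<Longrightarrow> mrestrict K l r Qs \<phi> \<Gamma> ss Ms = \<phi> \<Gamma> ss Ms"
  by (simp add: mrestrict_def)

lemma mrestrict_undefined:
  "(\<Gamma>, ss, Ms) \<notin> multimap_dom K l r Qs \<Longrightarrow> mrestrict K l r Qs \<phi> \<Gamma> ss Ms = undefined"
  by (simp add: mrestrict_def)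

lemma mrestrict_cong:
  "(\<And>\<Gamma> ss Ms. (\<Gamma>, ss, Ms) \<in> multimap_dom K l r Qs \<Longrightarrow> \<phi> \<Gamma> ss Ms = \<psi> \<Gamma> ss Ms) \<Longrightarrow>
    mrestrict K l r Qs \<phi> = mrestrict K l r Qs \<psi>"
  by (auto simp: mrestrict_def fun_eq_iff)

lemma mrestrict_eqI:
  assumes "\<psi> \<in> multimaps K l r Qs \<Omega>"
    "\<And>\<Gamma> ss Ms. (\<Gamma>, ss, Ms) \<in> multimap_dom K l r Qs \<Longrightarrow> \<phi> \<Gamma> ss Ms = \<psi> \<Gamma> ss Ms"
  shows "mrestrict K l r Qs \<phi> = \<psi>"
  using assms by (auto simp: mrestrict_def fun_eq_iff multimaps_def)

lemma mcomp_eq: "mcomp K l r as bs cs g f = mrestrict K l r (as @ bs @ cs) (\<lambda>\<Gamma> ss Ms.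
   g \<Gamma> (skip (length as) (length bs) ss) (graft (length as) (length bs)
     (f \<Gamma> (seg (length as) (Suc (length bs)) ss) (seg (length as) (length bs) Ms)) Ms))"
  by (simp add: mcomp_def skip_def seg_def graft_def Let_def)

lemma multimaps_closed:
  "\<phi> \<in> multimaps K l r Qs \<Omega> \<Longrightarrow> (\<Gamma>, ss, Ms) \<in> multimap_dom K l r Qs \<Longrightarrow>
    \<phi> \<Gamma> ss Ms \<in> car \<Omega> (ctx K \<Gamma> (hd ss)) (trg K (last ss))"
  unfolding multimaps_def by blast

lemma multimaps_undefined:
  "\<phi> \<in> multimaps K l r Qs \<Omega> \<Longrightarrow> (\<Gamma>, ss, Ms) \<notin> multimap_dom K l r Qs \<Longrightarrow> \<phi> \<Gamma> ss Ms = undefined"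
  unfolding multimaps_def by blast

lemma multimaps_natural:
  "\<phi> \<in> multimaps K l r Qs \<Omega> \<Longrightarrow> \<sigma> \<in> arrows K \<Delta> \<Gamma> \<Longrightarrow> (\<Gamma>, ss, Ms) \<in> multimap_dom K l r Qs \<Longrightarrow>
    \<phi> \<Delta> ss (act_args K Qs \<sigma> ss Ms) = act \<Omega> (trg K (last ss)) (ctx_map K \<sigma> (hd ss)) (\<phi> \<Gamma> ss Ms)"
  unfolding multimaps_def by blast

lemma mor_bimod_iff:
  "f \<in> mor (bimod_multicat K) l r Qs \<Omega> \<longleftrightarrow> f \<in> multimaps K l r Qs \<Omega> \<and>
    (\<forall>Q\<in>set Qs. bimodule K Q) \<and> bimodule K \<Omega> \<and> (Qs = [] \<longrightarrow> l = Loose \<and> r = Loose)"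
  by (auto simp: mor_def bimod_multicat_def)

section \<open>Indices of the inner and of the outer morphism of a composite\<close>

lemma inner_simps [simp]: "inner l [] = l" "inner l (a # as) = Loose" "inner Loose as = Loose"
  by (auto simp: inner_def)

text \<open>The segment contains the left end of the list only if \<open>as\<close> is empty and the
  right end only if \<open>cs\<close> is empty, and exactly then \<open>inner\<close> keeps the
  tightness of that end. The last assumption reflects that a nullary inner morphism is loose on both
  sides.\<close>

lemma seg_dom:
  assumes "(\<Gamma>, ss, Ms) \<in> multimap_dom K l r (as @ bs @ cs)"
    "as @ bs @ cs = [] \<longrightarrow> l = Loose \<and> r = Loose"
    "bs = [] \<longrightarrow> inner l as = Loose \<and> inner r cs = Loose"
  shows "(\<Gamma>, seg (length as) (Suc (length bs)) ss, seg (length as) (length bs) Ms)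
    \<in> multimap_dom K (inner l as) (inner r cs) bs"
proof -
  note D = assms(1)[unfolded multimap_dom_iff[OF assms(2)]]
  have "stage_at K (inner l as) (inner r cs) (length bs) i (ss ! (length as + i))" if "i \<le> length bs" for i
  proof -
    have *: "stage_at K l r (length (as @ bs @ cs)) (length as + i) (ss ! (length as + i))"
      using D that by simp
    show ?thesis using * that assms(3) by (cases "ss ! (length as + i)")
      (auto simp: inner_def split: if_splits)
  qed
  moreover have "Ms ! (length as + i) \<in> car (bs ! i) (ctx K \<Gamma> (ss ! (length as + i))) (trg K (ss ! (length as + Suc i)))"
    if "i < length bs" for i
  proof -
    have "length as + i < length (as @ bs @ cs)" using that by simp
    then have "Ms ! (length as + i) \<in> car ((as @ bs @ cs) ! (length as + i))
        (ctx K \<Gamma> (ss ! (length as + i))) (trg K (ss ! Suc (length as + i)))"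
      using D by blast
    then show ?thesis using that by (simp add: nth_append)
  qed
  ultimately show ?thesis using D by (simp add: multimap_dom_iff[OF assms(3)])
qed

text \<open>For empty \<open>bs\<close> the stage at the hole is repeated and must serve both as a
  target and as a context. Looseness on both sides forces it to be a \<open>Mid\<close>
  stage.\<close>

lemma graft_dom:
  assumes "(\<Gamma>, ss, Ms) \<in> multimap_dom K l r (as @ bs @ cs)"
    "as @ bs @ cs = [] \<longrightarrow> l = Loose \<and> r = Loose"
    "bs = [] \<longrightarrow> inner l as = Loose \<and> inner r cs = Loose"
    "v \<in> car x (ctx K \<Gamma> (ss ! length as)) (trg K (ss ! (length as + length bs)))"
  shows "(\<Gamma>, skip (length as) (length bs) ss, graft (length as) (length bs) v Ms)
    \<in> multimap_dom K l r (as @ x # cs)"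
proof -
  let ?p = "length as" and ?q = "length bs" and ?n = "length (as @ x # cs)"
  note D = assms(1)[unfolded multimap_dom_iff[OF assms(2)]]
  have D1: "stage_at K l r (length (as @ bs @ cs)) i (ss ! i)" if "i \<le> length (as @ bs @ cs)" for i
    using D that by blast
  have D2: "Ms ! i \<in> car ((as @ bs @ cs) ! i) (ctx K \<Gamma> (ss ! i)) (trg K (ss ! Suc i))"
    if "i < length (as @ bs @ cs)" for i
    using D that by blast
  have "stage_at K l r ?n i (skip ?p ?q ss ! i)" if "i \<le> ?n" for i
  proof -
    let ?j = "if i \<le> ?p then i else i + ?q - 1"
    have "skip ?p ?q ss ! i = ss ! ?j" using D that by (subst nth_skip) auto
    moreover have "stage_at K l r (length (as @ bs @ cs)) ?j (ss ! ?j)"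
      using that by (intro D1) auto
    ultimately show ?thesis using that assms(3)
      by (cases "ss ! ?j"; cases as; cases bs) (auto simp: inner_def split: if_splits)
  qed
  moreover have "graft ?p ?q v Ms ! i \<in> car ((as @ x # cs) ! i)
      (ctx K \<Gamma> (skip ?p ?q ss ! i)) (trg K (skip ?p ?q ss ! Suc i))" if "i < ?n" for i
  proof -
    consider "i < ?p" | "i = ?p" | "i > ?p" by linarith
    then show ?thesis
    proof cases
      case 1
      then show ?thesis using D2[of i] D that by (simp add: nth_graft nth_skip nth_append)
    next
      case 2
      then show ?thesis using assms(4) D that by (simp add: nth_graft nth_skip nth_append)
    next
      case 3
      \<comment> \<open>Argument \<open>i\<close> of the outer morphism is then argument
        \<open>?p + j + ?q\<close> of the composite.\<close>
      then obtain j where j: "i = Suc (?p + j)" using less_iff_Suc_add by auto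
      then have "?p + j + ?q < length (as @ bs @ cs)" using that by simp
      from D2[OF this] show ?thesis using D that j by (simp add: nth_graft nth_skip nth_append)
    qed
  qed
  moreover have "\<Gamma> \<in> Ob K" "length (skip ?p ?q ss) = Suc ?n" "length (graft ?p ?q v Ms) = ?n"
    using D by auto
  ultimately show ?thesis by (subst multimap_dom_iff) blast+
qed

text \<open>The first and last stages of the segment are those that bound the hole, so the value of
  \<open>f\<close> has the type that the outer morphism expects there.\<close>

lemma graft_dom_multimap:
  assumes "(\<Gamma>, ss, Ms) \<in> multimap_dom K l r (as @ bs @ cs)"
    "as @ bs @ cs = [] \<longrightarrow> l = Loose \<and> r = Loose"
    "bs = [] \<longrightarrow> inner l as = Loose \<and> inner r cs = Loose"
    "f \<in> multimaps K (inner l as) (inner r cs) bs x"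
  shows "f \<Gamma> (seg (length as) (Suc (length bs)) ss) (seg (length as) (length bs) Ms)
     \<in> car x (ctx K \<Gamma> (ss ! length as)) (trg K (ss ! (length as + length bs)))" (is ?A)
   "(\<Gamma>, skip (length as) (length bs) ss, graft (length as) (length bs)
     (f \<Gamma> (seg (length as) (Suc (length bs)) ss) (seg (length as) (length bs) Ms)) Ms)
    \<in> multimap_dom K l r (as @ x # cs)" (is ?B)
proof -
  have l: "length ss = Suc (length (as @ bs @ cs))" using assms(1) multimap_dom_length by metis
  have "hd (seg (length as) (Suc (length bs)) ss) = ss ! length as"
    using l by (simp add: seg_def hd_drop_conv_nth)
  moreover have "last (seg (length as) (Suc (length bs)) ss) = ss ! (length as + length bs)"
    using l by (subst last_conv_nth) (auto simp: seg_def)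
  ultimately show ?A
    using multimaps_closed[OF assms(4) seg_dom[OF assms(1-3)]] by simp
  then show ?B by (rule graft_dom[OF assms(1-3)])
qed

section \<open>Stage lists under loosening\<close>

lemma stage_at_Suc: "stage_at K Loose r k (Suc i) s \<longleftrightarrow> stage_at K Tight r k (Suc i) s"
  by (cases s) auto

lemma stage_at_less: "i < k \<Longrightarrow> stage_at K l Loose k i s \<longleftrightarrow> stage_at K l Tight k i s"
  by (cases s) auto

lemma all_le_Suc: "(\<forall>i\<le>Suc n. P i) \<longleftrightarrow> P 0 \<and> (\<forall>i\<le>n. P (Suc i))"
  using All_less_Suc2[of "Suc n" P] by (simp add: less_Suc_eq_le)

text \<open>The left tightness matters only at position 0, and with at least one input this position
  is not the last.\<close>

lemma stages_Mid_Cons_iff: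
  "Mid A # ss \<in> stages K Loose r (Suc k) \<longleftrightarrow> A \<in> XX K \<and> Start # ss \<in> stages K Tight r (Suc k)"
  by (simp add: stages_iff all_le_Suc stage_at_Suc conj_ac)

lemma stages_Loose_ConsE:
  assumes "ss \<in> stages K Loose r (Suc k)"
  obtains A ss' where "ss = Mid A # ss'" "ss' \<noteq> []"
proof -
  have "length ss = Suc (Suc k)" "stage_at K Loose r (Suc k) 0 (ss ! 0)"
    using assms by (simp_all add: stages_iff)
  then obtain A ss' where "ss = Mid A # ss'" "length ss' = Suc k"
    by (cases ss; cases "ss ! 0") auto
  then show ?thesis using that by (cases ss') auto
qed

text \<open>Both last stages have the target \<open>FF K A\<close>; the assumption is what
  \<open>End\<close> demands of its target.\<close>

lemma stages_snoc_Mid_iff: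
  assumes "FF K A \<in> YY K"
  shows "ss @ [Mid A] \<in> stages K l Loose (Suc k) \<longleftrightarrow> A \<in> XX K \<and> ss @ [End (FF K A)] \<in> stages K l Tight (Suc k)"
proof (cases "length ss = Suc k")
  case True
  have "(\<forall>i\<le>Suc k. stage_at K l r (Suc k) i ((ss @ [s]) ! i)) \<longleftrightarrow>
    (\<forall>i<Suc k. stage_at K l r (Suc k) i (ss ! i)) \<and> stage_at K l r (Suc k) (Suc k) s" for r s
    using True All_less_Suc[of "Suc k" "\<lambda>i. stage_at K l r (Suc k) i ((ss @ [s]) ! i)"]
    by (simp add: less_Suc_eq_le nth_append conj_commute)
  then show ?thesis using assms True by (auto simp: stages_iff stage_at_less)
qed (simp add: stages_iff)

lemma stages_Loose_snocE:
  assumes "ss \<in> stages K l Loose (Suc k)"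
  obtains A ss' where "ss = ss' @ [Mid A]" "ss' \<noteq> []" "A \<in> XX K"
proof -
  have "length ss = Suc (Suc k)" "stage_at K l Loose (Suc k) (Suc k) (ss ! Suc k)"
    using assms by (simp_all add: stages_iff)
  then obtain A ss' where "ss = ss' @ [Mid A]" "length ss' = Suc k" "A \<in> XX K"
    by (cases ss rule: rev_cases; cases "ss ! Suc k") (auto simp: nth_append)
  then show ?thesis using that by (cases ss') auto
qed

text \<open>Equational form: for a fixed small arity it lets the simplifier determine the stage
  lists completely.\<close>

lemma stage_at_iff:
  "stage_at K l r k i s \<longleftrightarrow> (if l = Tight \<and> i = 0 then s = Start
    else if r = Tight \<and> i = k then \<exists>B\<in>YY K. s = End B else \<exists>A\<in>XX K. s = Mid A)"
  by (cases s) auto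

section \<open>Products in a cartesian base\<close>

text \<open>Bimodules are defined only over base records without extension fields.\<close>

locale plain_cartesian_base = cartesian_base K
  for K :: "('o, 'm, 'x, 'y) base" (structure)
begin

lemma arrows_Ob: "f \<in> arrows K x y \<Longrightarrow> x \<in> Ob K" "f \<in> arrows K x y \<Longrightarrow> y \<in> Ob K"
  using Dom_closed Cod_closed by (auto simp: arrows_def)

lemma jj_Ob [simp]: "A \<in> XX K \<Longrightarrow> jj K A \<in> Ob K"
  using jj_closed by auto

lemma FF_YY [simp]: "A \<in> XX K \<Longrightarrow> FF K A \<in> YY K"
  using FF_closed by auto

lemma pairing:
  assumes "f \<in> arrows K z x" "g \<in> arrows K z y"
  shows "pairing K f g \<in> arrows K z (x \<otimes> y)" "pairing K f g ;; Pr1 K x y = f" "pairing K f g ;; Pr2 K x y = g"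
proof -
  have eq: "Dom K f = z" "Cod K f = x" "Cod K g = y" using assms by (auto simp: arrows_def)
  have "pairing K f g \<in> arrows K z (x \<otimes> y) \<and> pairing K f g ;; Pr1 K x y = f \<and> pairing K f g ;; Pr2 K x y = g"
    using theI'[OF Prd_universal[OF assms]] by (simp add: pairing_def eq)
  then show "pairing K f g \<in> arrows K z (x \<otimes> y)" "pairing K f g ;; Pr1 K x y = f" "pairing K f g ;; Pr2 K x y = g"
    by auto
qed

lemma pairing_eqI:
  assumes "f \<in> arrows K z x" "g \<in> arrows K z y" "h \<in> arrows K z (x \<otimes> y)"
    "h ;; Pr1 K x y = f" "h ;; Pr2 K x y = g"
  shows "pairing K f g = h"
  using Prd_universal[OF assms(1,2)] pairing[OF assms(1,2)] assms(3-5) by blast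

lemma Cmp_pairing:
  assumes "\<sigma> \<in> arrows K w z" "f \<in> arrows K z x" "g \<in> arrows K z y"
  shows "\<sigma> ;; pairing K f g = pairing K (\<sigma> ;; f) (\<sigma> ;; g)"
proof -
  have Ob: "x \<in> Ob K" "y \<in> Ob K" using assms arrows_Ob by auto
  note p = pairing[OF assms(2,3)]
  show ?thesis
  proof (rule pairing_eqI[symmetric])
    show "\<sigma> ;; f \<in> arrows K w x" "\<sigma> ;; g \<in> arrows K w y" "\<sigma> ;; pairing K f g \<in> arrows K w (x \<otimes> y)"
      using assms p(1) by (auto intro: Cmp_arrows)
    show "(\<sigma> ;; pairing K f g) ;; Pr1 K x y = \<sigma> ;; f" "(\<sigma> ;; pairing K f g) ;; Pr2 K x y = \<sigma> ;; g"
      using Cmp_assoc[OF assms(1) p(1) Pr1_arrows[OF Ob]] Cmp_assoc[OF assms(1) p(1) Pr2_arrows[OF Ob]] p(2,3)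
      by simp_all
  qed
qed

lemma prod_map:
  assumes "f \<in> arrows K x x'" "g \<in> arrows K y y'"
  shows "prod_map K f g \<in> arrows K (x \<otimes> y) (x' \<otimes> y')"
    "prod_map K f g ;; Pr1 K x' y' = Pr1 K x y ;; f" "prod_map K f g ;; Pr2 K x' y' = Pr2 K x y ;; g"
proof -
  have eq: "Dom K f = x" "Dom K g = y" using assms by (auto simp: arrows_def)
  have "Pr1 K x y ;; f \<in> arrows K (x \<otimes> y) x'" "Pr2 K x y ;; g \<in> arrows K (x \<otimes> y) y'"
    using assms arrows_Ob by (meson Cmp_arrows Pr1_arrows Pr2_arrows)+
  from pairing[OF this] show "prod_map K f g \<in> arrows K (x \<otimes> y) (x' \<otimes> y')"
    "prod_map K f g ;; Pr1 K x' y' = Pr1 K x y ;; f" "prod_map K f g ;; Pr2 K x' y' = Pr2 K x y ;; g"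
    by (simp_all add: prod_map_def eq)
qed

lemma pairing_prod_map:
  assumes "f \<in> arrows K z x" "g \<in> arrows K z y" "h \<in> arrows K x x'" "k \<in> arrows K y y'"
  shows "pairing K f g ;; prod_map K h k = pairing K (f ;; h) (g ;; k)"
proof -
  have Ob: "x \<in> Ob K" "y \<in> Ob K" "x' \<in> Ob K" "y' \<in> Ob K" using assms arrows_Ob by auto
  note p = pairing[OF assms(1,2)] and q = prod_map[OF assms(3,4)]
  note pr = Pr1_arrows[OF Ob(1,2)] Pr2_arrows[OF Ob(1,2)] Pr1_arrows[OF Ob(3,4)] Pr2_arrows[OF Ob(3,4)]
  show ?thesis
  proof (rule pairing_eqI[symmetric])
    show "f ;; h \<in> arrows K z x'" "g ;; k \<in> arrows K z y'"
      "pairing K f g ;; prod_map K h k \<in> arrows K z (x' \<otimes> y')"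
      using assms p(1) q(1) by (auto intro: Cmp_arrows)
    show "(pairing K f g ;; prod_map K h k) ;; Pr1 K x' y' = f ;; h"
      using Cmp_assoc[OF p(1) q(1) pr(3)] Cmp_assoc[OF p(1) pr(1) assms(3)] p(2) q(2) by simp
    show "(pairing K f g ;; prod_map K h k) ;; Pr2 K x' y' = g ;; k"
      using Cmp_assoc[OF p(1) q(1) pr(4)] Cmp_assoc[OF p(1) pr(2) assms(4)] p(3) q(3) by simp
  qed
qed

lemma prod_map_pairing:
  assumes "f \<in> arrows K x x'" "g \<in> arrows K y y'"
  shows "prod_map K f g = pairing K (Pr1 K x y ;; f) (Pr2 K x y ;; g)"
  using assms by (auto simp: prod_map_def arrows_def)

lemma prod_map_Id:
  assumes "x \<in> Ob K" "y \<in> Ob K"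
  shows "prod_map K (Id K x) (Id K y) = Id K (x \<otimes> y)"
proof -
  note pr = Pr1_arrows[OF assms] Pr2_arrows[OF assms] Id_arrows[OF Prd_Ob[OF assms]]
  have "prod_map K (Id K x) (Id K y) = pairing K (Pr1 K x y) (Pr2 K x y)"
    using prod_map_pairing[OF Id_arrows Id_arrows, OF assms] Id_right[OF pr(1)] Id_right[OF pr(2)] by simp
  also have "\<dots> = Id K (x \<otimes> y)"
    by (rule pairing_eqI[OF pr]) (use Id_left[OF pr(1)] Id_left[OF pr(2)] in auto)
  finally show ?thesis .
qed

lemma prod_map_Cmp_Id:
  assumes "\<tau> \<in> arrows K x y" "\<sigma> \<in> arrows K y z" "w \<in> Ob K"
  shows "prod_map K (\<tau> ;; \<sigma>) (Id K w) = prod_map K \<tau> (Id K w) ;; prod_map K \<sigma> (Id K w)"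
proof -
  have Ob: "x \<in> Ob K" using assms arrows_Ob by auto
  note pr = Pr1_arrows[OF Ob assms(3)] Pr2_arrows[OF Ob assms(3)]
  note Id = Id_arrows[OF assms(3)]
  have "prod_map K \<tau> (Id K w) ;; prod_map K \<sigma> (Id K w)
    = pairing K (Pr1 K x w ;; \<tau>) (Pr2 K x w ;; Id K w) ;; prod_map K \<sigma> (Id K w)"
    using prod_map_pairing[OF assms(1) Id] by simp
  also have "\<dots> = pairing K ((Pr1 K x w ;; \<tau>) ;; \<sigma>) ((Pr2 K x w ;; Id K w) ;; Id K w)"
    by (rule pairing_prod_map[OF Cmp_arrows[OF pr(1) assms(1)] Cmp_arrows[OF pr(2) Id] assms(2) Id])
  also have "\<dots> = pairing K (Pr1 K x w ;; (\<tau> ;; \<sigma>)) (Pr2 K x w ;; Id K w)"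
    using Cmp_assoc[OF pr(1) assms(1,2)] Id_right[OF pr(2)] by simp
  also have "\<dots> = prod_map K (\<tau> ;; \<sigma>) (Id K w)"
    by (rule prod_map_pairing[OF Cmp_arrows[OF assms(1,2)] Id, symmetric])
  finally show ?thesis ..
qed

section \<open>Reindexing of arguments\<close>

text \<open>The stages that can be a context. On \<open>End\<close> both \<open>ctx\<close> and
  \<open>ctx_map\<close> are \<open>undefined\<close>, so typing and functoriality of
  \<open>ctx_map\<close> can hold only here.\<close>

definition source_stage :: "('x, 'y) stage \<Rightarrow> bool" where
  "source_stage s \<longleftrightarrow> s = Start \<or> (\<exists>A\<in>XX K. s = Mid A)"

lemma source_stage_simps [simp]: "source_stage Start" "source_stage (Mid A) \<longleftrightarrow> A \<in> XX K" "\<not> source_stage (End B)"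
  by (auto simp: source_stage_def)

lemma ctx_map_arrows:
  "\<sigma> \<in> arrows K \<Delta> \<Gamma> \<Longrightarrow> source_stage s \<Longrightarrow> ctx_map K \<sigma> s \<in> arrows K (ctx K \<Delta> s) (ctx K \<Gamma> s)"
  by (cases s) (auto simp: prod_map Id_arrows)

lemma ctx_map_Cmp:
  "\<tau> \<in> arrows K \<Theta> \<Delta> \<Longrightarrow> \<sigma> \<in> arrows K \<Delta> \<Gamma> \<Longrightarrow> source_stage s \<Longrightarrow>
    ctx_map K (\<tau> ;; \<sigma>) s = ctx_map K \<tau> s ;; ctx_map K \<sigma> s"
  by (cases s) (auto simp: prod_map_Cmp_Id)

text \<open>The part of \<open>multimap_dom\<close> that does not mention tightness. It passes to
  tails, which is where left-loosening reindexes.\<close>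

definition args :: "'o \<Rightarrow> ('o, 'm, 'y, 'e) bimodule list \<Rightarrow> ('x, 'y) stage list \<Rightarrow> 'e list \<Rightarrow> bool" where
  "args \<Gamma> Qs ss Ms \<longleftrightarrow> length ss = Suc (length Qs) \<and> length Ms = length Qs \<and>
    (\<forall>i<length Qs. source_stage (ss ! i) \<and> Ms ! i \<in> car (Qs ! i) (ctx K \<Gamma> (ss ! i)) (trg K (ss ! Suc i)))"

lemma args_Nil [simp]: "args \<Gamma> [] [s] []"
  by (simp add: args_def)

lemma args_Cons [simp]:
  "args \<Gamma> (Q # Qs) (s # t # ss) (M # Ms) \<longleftrightarrow>
    source_stage s \<and> M \<in> car Q (ctx K \<Gamma> s) (trg K t) \<and> args \<Gamma> Qs (t # ss) Ms"
  by (auto simp: args_def All_less_Suc2)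

lemma stages_source_stage:
  assumes "ss \<in> stages K l r k" "i < k"
  shows "source_stage (ss ! i)"
proof -
  have "stage_at K l r k i (ss ! i)" using assms stages_iff[of k l r ss K] by simp_all
  then show ?thesis using assms(2) by (cases "ss ! i") auto
qed

lemma multimap_dom_args_iff:
  "(\<Gamma>, ss, Ms) \<in> multimap_dom K l r Qs \<longleftrightarrow> \<Gamma> \<in> Ob K \<and> ss \<in> stages K l r (length Qs) \<and> args \<Gamma> Qs ss Ms"
proof -
  have "length ss = Suc (length Qs)" if "ss \<in> stages K l r (length Qs)"
    using that by (auto simp: stages_def)
  then show ?thesis
    using stages_source_stage by (auto simp: multimap_dom_def args_def)
qed

lemma length_act_args [simp]: "length (act_args K Qs \<sigma> ss Ms) = length Qs"
  by (simp add: act_args_def)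

lemma nth_act_args:
  "i < length Qs \<Longrightarrow>
    act_args K Qs \<sigma> ss Ms ! i = act (Qs ! i) (trg K (ss ! Suc i)) (ctx_map K \<sigma> (ss ! i)) (Ms ! i)"
  by (simp add: act_args_def)

lemma act_args_Nil [simp]: "act_args K [] \<sigma> ss Ms = []"
  by (simp add: act_args_def)

lemma act_args_Cons [simp]:
  "act_args K (Q # Qs) \<sigma> (s # ss) (M # Ms) = act Q (trg K (ss ! 0)) (ctx_map K \<sigma> s) M # act_args K Qs \<sigma> ss Ms"
  by (rule nth_equalityI) (auto simp: nth_act_args nth_Cons split: nat.splits)

lemma act_args_seg:
  assumes "length ss = Suc (length (as @ bs @ cs))" "length Ms = length (as @ bs @ cs)"
  shows "seg (length as) (length bs) (act_args K (as @ bs @ cs) \<sigma> ss Ms)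
    = act_args K bs \<sigma> (seg (length as) (Suc (length bs)) ss) (seg (length as) (length bs) Ms)"
  using assms by (intro nth_equalityI) (auto simp: nth_act_args nth_append)

text \<open>The grafted value has its context from the stage before the hole and its target from the
  stage after it, so it is reindexed like any other argument of the outer morphism.\<close>

lemma act_args_graft:
  assumes "length ss = Suc (length (as @ bs @ cs))" "length Ms = length (as @ bs @ cs)"
  shows "graft (length as) (length bs)
      (act x (trg K (ss ! (length as + length bs))) (ctx_map K \<sigma> (ss ! length as)) v)
      (act_args K (as @ bs @ cs) \<sigma> ss Ms)
    = act_args K (as @ x # cs) \<sigma> (skip (length as) (length bs) ss) (graft (length as) (length bs) v Ms)"
proof (rule nth_equalityI)
  fix i
  assume "i < length (graft (length as) (length bs)
      (act x (trg K (ss ! (length as + length bs))) (ctx_map K \<sigma> (ss ! length as)) v)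
      (act_args K (as @ bs @ cs) \<sigma> ss Ms))"
  then have i: "i < length (as @ x # cs)" by simp
  consider "i < length as" | "i = length as" | j where "i = Suc (length as + j)"
    using less_iff_Suc_add by (metis add_Suc_right linorder_neqE_nat)
  then show "graft (length as) (length bs)
      (act x (trg K (ss ! (length as + length bs))) (ctx_map K \<sigma> (ss ! length as)) v)
      (act_args K (as @ bs @ cs) \<sigma> ss Ms) ! i
    = act_args K (as @ x # cs) \<sigma> (skip (length as) (length bs) ss) (graft (length as) (length bs) v Ms) ! i"
    by cases (use i assms in \<open>simp_all add: nth_graft nth_act_args nth_skip nth_append\<close>)
qed (use assms in simp)

section \<open>Functoriality of reindexing\<close>

lemma args_act_args:
  assumes "args \<Gamma> Qs ss Ms" "\<sigma> \<in> arrows K \<Delta> \<Gamma>" "\<forall>Q\<in>set Qs. bimodule K Q"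
  shows "args \<Delta> Qs ss (act_args K Qs \<sigma> ss Ms)"
proof -
  have "act (Qs ! i) (trg K (ss ! Suc i)) (ctx_map K \<sigma> (ss ! i)) (Ms ! i)
      \<in> car (Qs ! i) (ctx K \<Delta> (ss ! i)) (trg K (ss ! Suc i))" if "i < length Qs" for i
    using assms that
    by (intro bimodule.act_closed[of K "Qs ! i" _ _ "ctx K \<Gamma> (ss ! i)"]) (auto simp: args_def ctx_map_arrows)
  then show ?thesis using assms(1) by (auto simp: args_def nth_act_args)
qed

lemma act_args_Cmp:
  assumes "args \<Gamma> Qs ss Ms" "\<tau> \<in> arrows K \<Theta> \<Delta>" "\<sigma> \<in> arrows K \<Delta> \<Gamma>" "\<forall>Q\<in>set Qs. bimodule K Q"
  shows "act_args K Qs (\<tau> ;; \<sigma>) ss Ms = act_args K Qs \<tau> ss (act_args K Qs \<sigma> ss Ms)"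
proof (rule nth_equalityI)
  fix i assume "i < length (act_args K Qs (\<tau> ;; \<sigma>) ss Ms)"
  then have i: "i < length Qs" by simp
  have "act (Qs ! i) (trg K (ss ! Suc i)) (ctx_map K \<tau> (ss ! i) ;; ctx_map K \<sigma> (ss ! i)) (Ms ! i)
    = act (Qs ! i) (trg K (ss ! Suc i)) (ctx_map K \<tau> (ss ! i))
        (act (Qs ! i) (trg K (ss ! Suc i)) (ctx_map K \<sigma> (ss ! i)) (Ms ! i))"
    using assms i by (intro bimodule.act_Cmp) (auto simp: args_def intro: ctx_map_arrows)
  then show "act_args K Qs (\<tau> ;; \<sigma>) ss Ms ! i = act_args K Qs \<tau> ss (act_args K Qs \<sigma> ss Ms) ! i"
    using assms i by (simp add: nth_act_args ctx_map_Cmp[of \<tau> \<Theta> \<Delta> \<sigma> \<Gamma>] args_def)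
qed simp

lemma multimap_dom_act_args:
  assumes "(\<Gamma>, ss, Ms) \<in> multimap_dom K l r Qs" "\<sigma> \<in> arrows K \<Delta> \<Gamma>" "\<forall>Q\<in>set Qs. bimodule K Q"
  shows "(\<Delta>, ss, act_args K Qs \<sigma> ss Ms) \<in> multimap_dom K l r Qs"
  using assms args_act_args arrows_Ob unfolding multimap_dom_args_iff by blast

text \<open>Index sets are closed under reindexing, so typing and naturality need to be checked for
  the unrestricted function only.\<close>

lemma mrestrict_multimaps:
  assumes "\<forall>Q\<in>set Qs. bimodule K Q"
    and "\<And>\<Gamma> ss Ms. (\<Gamma>, ss, Ms) \<in> multimap_dom K l r Qs \<Longrightarrow>
      \<phi> \<Gamma> ss Ms \<in> car \<Omega> (ctx K \<Gamma> (hd ss)) (trg K (last ss))"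
    and "\<And>\<Delta> \<Gamma> \<sigma> ss Ms. \<sigma> \<in> arrows K \<Delta> \<Gamma> \<Longrightarrow> (\<Gamma>, ss, Ms) \<in> multimap_dom K l r Qs \<Longrightarrow>
      (\<Delta>, ss, act_args K Qs \<sigma> ss Ms) \<in> multimap_dom K l r Qs \<Longrightarrow>
      \<phi> \<Delta> ss (act_args K Qs \<sigma> ss Ms) = act \<Omega> (trg K (last ss)) (ctx_map K \<sigma> (hd ss)) (\<phi> \<Gamma> ss Ms)"
  shows "mrestrict K l r Qs \<phi> \<in> multimaps K l r Qs \<Omega>"
  unfolding multimaps_def
proof (intro CollectI conjI allI impI)
  show "mrestrict K l r Qs \<phi> \<Delta> ss (act_args K Qs \<sigma> ss Ms)
      = act \<Omega> (trg K (last ss)) (ctx_map K \<sigma> (hd ss)) (mrestrict K l r Qs \<phi> \<Gamma> ss Ms)"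
    if "\<sigma> \<in> arrows K \<Delta> \<Gamma>" "(\<Gamma>, ss, Ms) \<in> multimap_dom K l r Qs" for \<Delta> \<Gamma> \<sigma> ss Ms
    using that assms(3)[OF that] multimap_dom_act_args[OF that(2,1) assms(1)] by simp
qed (use assms(2) in \<open>simp_all add: mrestrict_undefined\<close>)

section \<open>Loosening, identities and composition\<close>

lemma act_args_cong:
  assumes "\<And>i. i < length Qs \<Longrightarrow> trg K (ss ! Suc i) = trg K (ss' ! Suc i)"
    "\<And>i. i < length Qs \<Longrightarrow> ctx_map K \<sigma> (ss ! i) = ctx_map K \<sigma> (ss' ! i)"
  shows "act_args K Qs \<sigma> ss Ms = act_args K Qs \<sigma> ss' Ms"
  by (rule nth_equalityI) (auto simp: nth_act_args assms)

text \<open>The last stage is used only as a target, and \<open>Mid A\<close> and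
  \<open>End (FF K A)\<close> have the same one.\<close>

lemma act_args_snoc_Mid:
  "length ss = length Qs \<Longrightarrow>
    act_args K Qs \<sigma> (ss @ [Mid A]) Ms = act_args K Qs \<sigma> (ss @ [End (FF K A)]) Ms"
  by (rule act_args_cong) (auto simp: nth_append)

lemma args_snoc_Mid:
  "length ss = length Qs \<Longrightarrow> args \<Gamma> Qs (ss @ [Mid A]) Ms \<longleftrightarrow> args \<Gamma> Qs (ss @ [End (FF K A)]) Ms"
proof -
  assume *: "length ss = length Qs"
  have "trg K ((ss @ [Mid A]) ! Suc i) = trg K ((ss @ [End (FF K A)]) ! Suc i)" if "i < length Qs" for i
    using * that by (auto simp: nth_append)
  then show ?thesis using * by (auto simp: args_def nth_append)
qed

lemma Pr1_natural_jj:
  assumes "\<sigma> \<in> arrows K \<Delta> \<Gamma>" "A \<in> XX K"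
  shows "prod_map K \<sigma> (Id K (jj K A)) ;; Pr1 K \<Gamma> (jj K A) = Pr1 K \<Delta> (jj K A) ;; \<sigma>"
  using prod_map(2)[OF assms(1) Id_arrows] assms(2) by simp

text \<open>The context of \<open>Mid A\<close> over \<Gamma> is the context of \<open>Start\<close>
  over \<open>\<Gamma> \<times> jA\<close>. Hence the first argument stays as it is, and the others
  are weakened along \<pi>.\<close>

lemma args_Mid_Cons_loosen:
  assumes "args \<Gamma> (Q # Qs) (Mid A # ss) (M # Ms)" "\<forall>Q\<in>set Qs. bimodule K Q" "\<Gamma> \<in> Ob K"
  shows "args (\<Gamma> \<otimes> jj K A) (Q # Qs) (Start # ss) (M # act_args K Qs (Pr1 K \<Gamma> (jj K A)) ss Ms)"
proof -
  have "ss \<noteq> []" using assms by (auto simp: args_def)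
  then obtain t ts where ss: "ss = t # ts" by (cases ss) auto
  show ?thesis
    using assms args_act_args[OF _ Pr1_arrows[OF assms(3)] assms(2)] by (simp add: ss)
qed

text \<open>Splits an index of a left-loosened morphism and supplies the index at which the original
  morphism is evaluated.\<close>

lemma multimap_dom_Loose_Cons:
  assumes "(\<Gamma>, ss, Ms) \<in> multimap_dom K Loose r (Q # Qs)" "\<forall>Q\<in>set Qs. bimodule K Q"
  obtains A ss' M Ms' where "ss = Mid A # ss'" "Ms = M # Ms'" "ss' \<noteq> []" "A \<in> XX K" "\<Gamma> \<in> Ob K"
    "args \<Gamma> Qs ss' Ms'" "M \<in> car Q (\<Gamma> \<otimes> jj K A) (trg K (hd ss'))"
    "(\<Gamma> \<otimes> jj K A, Start # ss', M # act_args K Qs (Pr1 K \<Gamma> (jj K A)) ss' Ms')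
      \<in> multimap_dom K Tight r (Q # Qs)"
proof -
  have D: "\<Gamma> \<in> Ob K" "ss \<in> stages K Loose r (Suc (length Qs))" "args \<Gamma> (Q # Qs) ss Ms"
    using assms(1) by (auto simp: multimap_dom_args_iff)
  obtain A ss' where ss: "ss = Mid A # ss'" "ss' \<noteq> []" using D(2) by (rule stages_Loose_ConsE)
  obtain M Ms' where Ms: "Ms = M # Ms'" using D(3) by (cases Ms) (auto simp: args_def)
  have A: "A \<in> XX K" "Start # ss' \<in> stages K Tight r (Suc (length Qs))"
    using D(2) ss by (auto simp: stages_Mid_Cons_iff)
  have *: "args (\<Gamma> \<otimes> jj K A) (Q # Qs) (Start # ss') (M # act_args K Qs (Pr1 K \<Gamma> (jj K A)) ss' Ms')"
    using args_Mid_Cons_loosen[OF _ assms(2) D(1)] D(3) ss(1) Ms by simp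
  have "args \<Gamma> Qs ss' Ms'" "M \<in> car Q (\<Gamma> \<otimes> jj K A) (trg K (hd ss'))"
    using D(3) ss Ms by (cases ss'; simp)+
  moreover have "(\<Gamma> \<otimes> jj K A, Start # ss', M # act_args K Qs (Pr1 K \<Gamma> (jj K A)) ss' Ms')
      \<in> multimap_dom K Tight r (Q # Qs)"
    using * A D(1) by (simp add: multimap_dom_args_iff Prd_Ob)
  ultimately show ?thesis using that[OF ss(1) Ms ss(2) A(1) D(1)] by blast
qed

lemma mloosen_left_apply:
  "(\<Gamma>, Mid A # ss, M # Ms) \<in> multimap_dom K Loose r (Q # Qs) \<Longrightarrow>
    mloosen_left K r (Q # Qs) \<phi> \<Gamma> (Mid A # ss) (M # Ms) =
    \<phi> (\<Gamma> \<otimes> jj K A) (Start # ss) (M # act_args K Qs (Pr1 K \<Gamma> (jj K A)) ss Ms)"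
  by (simp add: mloosen_left_def)

lemma multimap_dom_Loose_snoc:
  assumes "(\<Gamma>, ss, Ms) \<in> multimap_dom K l Loose Qs" "Qs \<noteq> []"
  obtains A ss' where "ss = ss' @ [Mid A]" "A \<in> XX K" "length ss' = length Qs"
    "(\<Gamma>, ss' @ [End (FF K A)], Ms) \<in> multimap_dom K l Tight Qs"
proof -
  have D: "\<Gamma> \<in> Ob K" "ss \<in> stages K l Loose (Suc (length Qs - 1))" "args \<Gamma> Qs ss Ms"
    using assms by (auto simp: multimap_dom_args_iff)
  obtain A ss' where ss: "ss = ss' @ [Mid A]" "ss' \<noteq> []" "A \<in> XX K" using D(2) by (rule stages_Loose_snocE)
  have len: "length ss' = length Qs" using D ss by (simp add: args_def)
  have "ss' @ [End (FF K A)] \<in> stages K l Tight (Suc (length Qs - 1))"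
    using D(2) ss(1,3) stages_snoc_Mid_iff[of K A ss'] by simp
  then have "(\<Gamma>, ss' @ [End (FF K A)], Ms) \<in> multimap_dom K l Tight Qs"
    using D(1,3) assms(2) args_snoc_Mid[OF len] ss(1) by (simp add: multimap_dom_args_iff)
  with ss(1,3) len show ?thesis by (rule that)
qed

lemma mloosen_right_apply:
  "(\<Gamma>, ss @ [Mid A], Ms) \<in> multimap_dom K l Loose Qs \<Longrightarrow>
    mloosen_right K l Qs \<phi> \<Gamma> (ss @ [Mid A]) Ms = \<phi> \<Gamma> (ss @ [End (FF K A)]) Ms"
  by (simp add: mloosen_right_def)

section \<open>Typing and naturality of the operations\<close>

lemma mloosen_left_mor:
  assumes "\<phi> \<in> mor (bimod_multicat K) Tight r Qs \<Omega>"
  shows "mloosen_left K r Qs \<phi> \<in> mor (bimod_multicat K) Loose r Qs \<Omega>"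
proof -
  note \<phi> = assms[unfolded mor_bimod_iff]
  then have \<phi>': "\<phi> \<in> multimaps K Tight r Qs \<Omega>" by blast
  obtain Q Qs' where Qs: "Qs = Q # Qs'" using \<phi> by (cases Qs) auto
  have bim: "\<forall>Q\<in>set Qs'. bimodule K Q" using \<phi> Qs by auto
  have "mloosen_left K r Qs \<phi> \<in> multimaps K Loose r Qs \<Omega>"
    unfolding mloosen_left_def
  proof (rule mrestrict_multimaps)
    fix \<Gamma> ss Ms assume D: "(\<Gamma>, ss, Ms) \<in> multimap_dom K Loose r Qs"
    obtain A ss' M Ms' where ss: "ss = Mid A # ss'" "Ms = M # Ms'" "ss' \<noteq> []" "A \<in> XX K" "\<Gamma> \<in> Ob K"
      and a: "args \<Gamma> Qs' ss' Ms'" and M: "M \<in> car Q (\<Gamma> \<otimes> jj K A) (trg K (hd ss'))"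
      and D': "(\<Gamma> \<otimes> jj K A, Start # ss', M # act_args K Qs' (Pr1 K \<Gamma> (jj K A)) ss' Ms')
        \<in> multimap_dom K Tight r (Q # Qs')"
      using D bim unfolding Qs by (rule multimap_dom_Loose_Cons)
    let ?L = "\<lambda>\<Gamma> ss Ms. case hd ss of Mid A \<Rightarrow>
        \<phi> (\<Gamma> \<otimes> jj K A) (Start # tl ss) (hd Ms # act_args K (tl Qs) (Pr1 K \<Gamma> (jj K A)) (tl ss) (tl Ms))"
    show "?L \<Gamma> ss Ms \<in> car \<Omega> (ctx K \<Gamma> (hd ss)) (trg K (last ss))"
      using multimaps_closed[OF \<phi>'[unfolded Qs] D'] ss(1-3) by (simp add: Qs)
    fix \<Delta> \<sigma> assume \<sigma>: "\<sigma> \<in> arrows K \<Delta> \<Gamma>"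
    have Ob: "\<Delta> \<in> Ob K" "jj K A \<in> Ob K" using \<sigma> arrows_Ob ss by auto
    have \<sigma>A: "prod_map K \<sigma> (Id K (jj K A)) \<in> arrows K (\<Delta> \<otimes> jj K A) (\<Gamma> \<otimes> jj K A)"
      using \<sigma> Ob by (intro prod_map Id_arrows)
    \<comment> \<open>Reindexing along \<sigma> and then weakening equals weakening and then
      reindexing along \<open>\<sigma> \<times> jA\<close>, because
      \<open>\<pi>; \<sigma> = (\<sigma> \<times> jA); \<pi>\<close> and reindexing is
      functorial.\<close>
    have "act_args K Qs' (Pr1 K \<Delta> (jj K A)) ss' (act_args K Qs' \<sigma> ss' Ms')
      = act_args K Qs' (Pr1 K \<Delta> (jj K A) ;; \<sigma>) ss' Ms'"
      using a Pr1_arrows[OF Ob] \<sigma> bim by (rule act_args_Cmp[symmetric])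
    also have "\<dots> = act_args K Qs' (prod_map K \<sigma> (Id K (jj K A)) ;; Pr1 K \<Gamma> (jj K A)) ss' Ms'"
      using Pr1_natural_jj[OF \<sigma> ss(4)] by simp
    also have "\<dots> = act_args K Qs' (prod_map K \<sigma> (Id K (jj K A))) ss' (act_args K Qs' (Pr1 K \<Gamma> (jj K A)) ss' Ms')"
      using a \<sigma>A Pr1_arrows[OF ss(5) Ob(2)] bim by (rule act_args_Cmp)
    finally have "?L \<Delta> ss (act_args K Qs \<sigma> ss Ms) = \<phi> (\<Delta> \<otimes> jj K A) (Start # ss')
       (act_args K (Q # Qs') (prod_map K \<sigma> (Id K (jj K A))) (Start # ss')
         (M # act_args K Qs' (Pr1 K \<Gamma> (jj K A)) ss' Ms'))"
      by (simp add: ss(1,2) Qs)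
    also have "\<dots> = act \<Omega> (trg K (last ss)) (ctx_map K \<sigma> (hd ss)) (?L \<Gamma> ss Ms)"
      using multimaps_natural[OF \<phi>'[unfolded Qs] \<sigma>A D'] ss(1,2,3) by (simp add: Qs)
    finally show "?L \<Delta> ss (act_args K Qs \<sigma> ss Ms)
      = act \<Omega> (trg K (last ss)) (ctx_map K \<sigma> (hd ss)) (?L \<Gamma> ss Ms)" .
  qed (use \<phi> in auto)
  then show ?thesis using \<phi> Qs by (auto simp: mor_bimod_iff)
qed

text \<open>Contexts and arguments stay fixed and the new last stage has the same target, so
  naturality is inherited directly.\<close>

lemma mloosen_right_mor:
  assumes "\<phi> \<in> mor (bimod_multicat K) l Tight Qs \<Omega>"
  shows "mloosen_right K l Qs \<phi> \<in> mor (bimod_multicat K) l Loose Qs \<Omega>"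
proof -
  note \<phi> = assms[unfolded mor_bimod_iff]
  then have \<phi>': "\<phi> \<in> multimaps K l Tight Qs \<Omega>" by blast
  have Qs: "Qs \<noteq> []" using \<phi> by auto
  have "mloosen_right K l Qs \<phi> \<in> multimaps K l Loose Qs \<Omega>"
    unfolding mloosen_right_def
  proof (rule mrestrict_multimaps)
    fix \<Gamma> ss Ms assume D: "(\<Gamma>, ss, Ms) \<in> multimap_dom K l Loose Qs"
    obtain A ss' where ss: "ss = ss' @ [Mid A]" "A \<in> XX K" "length ss' = length Qs"
      and D': "(\<Gamma>, ss' @ [End (FF K A)], Ms) \<in> multimap_dom K l Tight Qs"
      using D Qs by (rule multimap_dom_Loose_snoc)
    have ne: "ss' \<noteq> []" using Qs ss(3) by auto
    let ?R = "\<lambda>\<Gamma> ss Ms. case last ss of Mid A \<Rightarrow> \<phi> \<Gamma> (butlast ss @ [End (FF K A)]) Ms"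
    show "?R \<Gamma> ss Ms \<in> car \<Omega> (ctx K \<Gamma> (hd ss)) (trg K (last ss))"
      using multimaps_closed[OF \<phi>' D'] ss(1) ne by simp
    fix \<Delta> \<sigma> assume \<sigma>: "\<sigma> \<in> arrows K \<Delta> \<Gamma>"
    show "?R \<Delta> ss (act_args K Qs \<sigma> ss Ms)
      = act \<Omega> (trg K (last ss)) (ctx_map K \<sigma> (hd ss)) (?R \<Gamma> ss Ms)"
      using multimaps_natural[OF \<phi>' \<sigma> D'] ss(1) ne by (simp add: act_args_snoc_Mid[OF ss(3)])
  qed (use \<phi> in auto)
  then show ?thesis using \<phi> Qs by (auto simp: mor_bimod_iff)
qed

lemma mident_mor:
  assumes "bimodule K Q"
  shows "mident K Q \<in> mor (bimod_multicat K) Tight Tight [Q] Q"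
proof -
  have "mident K Q \<in> multimaps K Tight Tight [Q] Q"
    unfolding mident_def
  proof (rule mrestrict_multimaps)
    fix \<Gamma> ss Ms assume D: "(\<Gamma>, ss, Ms) \<in> multimap_dom K Tight Tight [Q]"
    then have "length ss = Suc (Suc 0)" "length Ms = Suc 0" using multimap_dom_length by fastforce+
    then obtain s t M where ss: "ss = [s, t]" "Ms = [M]" by (auto simp: length_Suc_conv)
    show "hd Ms \<in> car Q (ctx K \<Gamma> (hd ss)) (trg K (last ss))"
      using D by (simp add: multimap_dom_args_iff ss)
    show "hd (act_args K [Q] \<sigma> ss Ms) = act Q (trg K (last ss)) (ctx_map K \<sigma> (hd ss)) (hd Ms)" for \<sigma>
      by (simp add: ss)
  qed (use assms in auto)
  then show ?thesis using assms by (simp add: mor_bimod_iff)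
qed

text \<open>Naturality of \<open>f\<close> turns its value into one more reindexed argument; then
  naturality of \<open>g\<close> applies to the grafted list.\<close>

lemma mcomp_mor:
  assumes "g \<in> mor (bimod_multicat K) l r (as @ x # cs) y"
    "f \<in> mor (bimod_multicat K) (inner l as) (inner r cs) bs x"
  shows "mcomp K l r as bs cs g f \<in> mor (bimod_multicat K) l r (as @ bs @ cs) y"
proof -
  note g = assms(1)[unfolded mor_bimod_iff] and f = assms(2)[unfolded mor_bimod_iff]
  have g': "g \<in> multimaps K l r (as @ x # cs) y" and f': "f \<in> multimaps K (inner l as) (inner r cs) bs x"
    using f g by blast+
  let ?p = "length as" and ?q = "length bs"
  have bs: "bs = [] \<longrightarrow> inner l as = Loose \<and> inner r cs = Loose" using f by auto
  have val: "as @ bs @ cs = [] \<longrightarrow> l = Loose \<and> r = Loose" using bs by auto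
  have bim: "\<forall>Q\<in>set (as @ bs @ cs). bimodule K Q" using f g by auto
  have "mcomp K l r as bs cs g f \<in> multimaps K l r (as @ bs @ cs) y"
    unfolding mcomp_eq
  proof (rule mrestrict_multimaps)
    fix \<Gamma> ss Ms assume D: "(\<Gamma>, ss, Ms) \<in> multimap_dom K l r (as @ bs @ cs)"
    note len = multimap_dom_length[OF D]
    note D' = graft_dom_multimap(2)[OF D val bs f'] and D'' = seg_dom[OF D val bs]
    let ?F = "\<lambda>\<Gamma> ss Ms. f \<Gamma> (seg ?p (Suc ?q) ss) (seg ?p ?q Ms)"
    let ?G = "\<lambda>\<Gamma> ss Ms. g \<Gamma> (skip ?p ?q ss) (graft ?p ?q (?F \<Gamma> ss Ms) Ms)"
    have "ss \<noteq> []" using len by auto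
    then have hl: "hd (skip ?p ?q ss) = hd ss" "last (skip ?p ?q ss) = last ss"
      "hd (seg ?p (Suc ?q) ss) = ss ! ?p" "last (seg ?p (Suc ?q) ss) = ss ! (?p + ?q)"
      using len by (auto simp: hd_skip last_skip hd_seg last_seg)
    show "?G \<Gamma> ss Ms \<in> car y (ctx K \<Gamma> (hd ss)) (trg K (last ss))"
      using multimaps_closed[OF g' D'] hl by simp
    fix \<Delta> \<sigma> assume \<sigma>: "\<sigma> \<in> arrows K \<Delta> \<Gamma>"
    have "?F \<Delta> ss (act_args K (as @ bs @ cs) \<sigma> ss Ms)
      = act x (trg K (ss ! (?p + ?q))) (ctx_map K \<sigma> (ss ! ?p)) (?F \<Gamma> ss Ms)"
      using multimaps_natural[OF f' \<sigma> D''] hl by (simp add: act_args_seg[OF len])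
    then have "?G \<Delta> ss (act_args K (as @ bs @ cs) \<sigma> ss Ms)
      = g \<Delta> (skip ?p ?q ss) (act_args K (as @ x # cs) \<sigma> (skip ?p ?q ss) (graft ?p ?q (?F \<Gamma> ss Ms) Ms))"
      by (simp add: act_args_graft[OF len])
    also have "\<dots> = act y (trg K (last ss)) (ctx_map K \<sigma> (hd ss)) (?G \<Gamma> ss Ms)"
      using multimaps_natural[OF g' \<sigma> D'] hl by simp
    finally show "?G \<Delta> ss (act_args K (as @ bs @ cs) \<sigma> ss Ms)
      = act y (trg K (last ss)) (ctx_map K \<sigma> (hd ss)) (?G \<Gamma> ss Ms)" .
  qed (use bim in blast)
  then show ?thesis using g bim val by (auto simp: mor_bimod_iff)
qed

section \<open>The axioms of a bi-skew multicategory\<close>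

lemma mcomp_apply:
  "(\<Gamma>, ss, Ms) \<in> multimap_dom K l r (as @ bs @ cs) \<Longrightarrow>
    mcomp K l r as bs cs g f \<Gamma> ss Ms = g \<Gamma> (skip (length as) (length bs) ss)
      (graft (length as) (length bs)
        (f \<Gamma> (seg (length as) (Suc (length bs)) ss) (seg (length as) (length bs) Ms)) Ms)"
  by (simp add: mcomp_eq)

lemma mloosen_commute:
  assumes "\<phi> \<in> mor (bimod_multicat K) Tight Tight Qs \<Omega>"
  shows "mloosen_right K Loose Qs (mloosen_left K Tight Qs \<phi>) = mloosen_left K Loose Qs (mloosen_right K Tight Qs \<phi>)"
proof -
  note \<phi> = assms[unfolded mor_bimod_iff]
  obtain Q Qs' where Qs: "Qs = Q # Qs'" using \<phi> by (cases Qs) auto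
  have bim: "\<forall>Q\<in>set Qs'. bimodule K Q" using \<phi> Qs by auto
  have "mloosen_right K Loose Qs (mloosen_left K Tight Qs \<phi>) \<Gamma> ss Ms
    = mloosen_left K Loose Qs (mloosen_right K Tight Qs \<phi>) \<Gamma> ss Ms"
    if D: "(\<Gamma>, ss, Ms) \<in> multimap_dom K Loose Loose Qs" for \<Gamma> ss Ms
  proof -
    obtain B ts where ts: "ss = ts @ [Mid B]" "B \<in> XX K" "length ts = length Qs"
      and D1: "(\<Gamma>, ts @ [End (FF K B)], Ms) \<in> multimap_dom K Loose Tight Qs"
      using D by (rule multimap_dom_Loose_snoc) (use Qs in auto)
    obtain A ss' M Ms' where ss: "ss = Mid A # ss'" "Ms = M # Ms'" "ss' \<noteq> []"
      and D2: "(\<Gamma> \<otimes> jj K A, Start # ss', M # act_args K Qs' (Pr1 K \<Gamma> (jj K A)) ss' Ms')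
        \<in> multimap_dom K Tight Loose (Q # Qs')"
      using D bim unfolding Qs by (rule multimap_dom_Loose_Cons)
    \<comment> \<open>As \<open>ss'\<close> is nonempty, the stages exchanged at the two ends are
      distinct entries of the list.\<close>
    obtain us where us: "ts = Mid A # us" "ss' = us @ [Mid B]"
      using ss(1,3) ts(1) by (cases ts) auto
    have len: "length us = length Qs'" using ts(3) us Qs by simp
    show ?thesis
      using D D1 D2 mloosen_right_apply[of \<Gamma> "Mid A # us" B Ms Loose Qs]
        mloosen_right_apply[of "\<Gamma> \<otimes> jj K A" "Start # us" B _ Tight Qs]
      by (simp add: ts ss us Qs mloosen_left_apply act_args_snoc_Mid[OF len])
  qed
  then show ?thesis by (auto simp: fun_eq_iff mloosen_left_def mloosen_right_def mrestrict_def)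
qed

text \<open>If \<open>as\<close> is empty, \<open>f\<close> fills the first input and is itself
  loosened, so both sides weaken the same arguments along the same projection. Otherwise the left
  side evaluates \<open>f\<close> in context \<open>\<Gamma> \<times> jA\<close> on weakened
  arguments, while the right side evaluates it in \<Gamma> and weakens the value.\<close>

lemma mloosen_left_mcomp:
  assumes "g \<in> mor (bimod_multicat K) Tight r (as @ x # cs) y"
    "f \<in> mor (bimod_multicat K) (inner Tight as) (inner r cs) bs x"
  shows "mloosen_left K r (as @ bs @ cs) (mcomp K Tight r as bs cs g f)
    = mcomp K Loose r as bs cs (mloosen_left K r (as @ x # cs) g)
        (if as = [] then mloosen_left K (inner r cs) bs f else f)"
proof -
  note g = assms(1)[unfolded mor_bimod_iff] and f = assms(2)[unfolded mor_bimod_iff]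
  have f': "f \<in> multimaps K (inner Tight as) (inner r cs) bs x"
    and bs: "bs = [] \<longrightarrow> inner Tight as = Loose \<and> inner r cs = Loose"
    using f by blast+
  let ?f = "if as = [] then mloosen_left K (inner r cs) bs f else f"
  have fl: "?f \<in> mor (bimod_multicat K) (inner Loose as) (inner r cs) bs x"
    using assms(2) mloosen_left_mor by (auto simp: inner_def)
  have val: "as @ bs @ cs = [] \<longrightarrow> Loose = Loose \<and> r = Loose" using bs by auto
  have bim: "\<forall>Q\<in>set as. bimodule K Q" "\<forall>Q\<in>set bs. bimodule K Q" "\<forall>Q\<in>set cs. bimodule K Q"
    using f g by auto
  have "mloosen_left K r (as @ bs @ cs) (mcomp K Tight r as bs cs g f) \<Gamma> ss Ms
      = mcomp K Loose r as bs cs (mloosen_left K r (as @ x # cs) g) ?f \<Gamma> ss Ms"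
    if D: "(\<Gamma>, ss, Ms) \<in> multimap_dom K Loose r (as @ bs @ cs)" for \<Gamma> ss Ms
  proof -
    have bs': "bs = [] \<longrightarrow> inner Loose as = Loose \<and> inner r cs = Loose" using bs by auto
    note Dg = graft_dom_multimap(2)[OF D val bs' fl[unfolded mor_bimod_iff, THEN conjunct1]]
    note Df = seg_dom[OF D val bs']
    show ?thesis
    proof (cases as)
      case Nil
      \<comment> \<open>Here \<open>f\<close> is left-tight, hence has at least one input.\<close>
      obtain b bs1 where bs1: "bs = b # bs1" using bs Nil by (cases bs) auto
      have "\<forall>Q\<in>set (bs1 @ cs). bimodule K Q" using bim bs1 by auto
      with D[unfolded Nil bs1, simplified]
      obtain A ss' M Ms' where ss: "ss = Mid A # ss'" "Ms = M # Ms'" "ss' \<noteq> []"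
        and D': "(\<Gamma> \<otimes> jj K A, Start # ss', M # act_args K (bs1 @ cs) (Pr1 K \<Gamma> (jj K A)) ss' Ms')
        \<in> multimap_dom K Tight r (b # bs1 @ cs)"
        by (rule multimap_dom_Loose_Cons)
      have len: "length ss' = Suc (length bs1 + length cs)" "length Ms' = length bs1 + length cs"
        using multimap_dom_length[OF D] by (auto simp: ss Nil bs1)
      \<comment> \<open>Weakening the tail splits at \<open>length bs1\<close> into the remaining
        inputs of \<open>f\<close> and the remaining inputs of \<open>g\<close>.\<close>
      have 1: "take (length bs1) (act_args K (bs1 @ cs) \<sigma> ss' Ms')
          = act_args K bs1 \<sigma> (take (Suc (length bs1)) ss') (take (length bs1) Ms')" for \<sigma>
        using len by (intro nth_equalityI) (auto simp: nth_act_args nth_append)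
      have 2: "drop (length bs1) (act_args K (bs1 @ cs) \<sigma> ss' Ms')
          = act_args K cs \<sigma> (drop (length bs1) ss') (drop (length bs1) Ms')" for \<sigma>
        using len by (intro nth_equalityI) (auto simp: nth_act_args)
      show ?thesis using D D' Dg Df
        mcomp_apply[of "\<Gamma> \<otimes> jj K A" "Start # ss'" "M # act_args K (bs1 @ cs) (Pr1 K \<Gamma> (jj K A)) ss' Ms'"
          Tight r "[]" "b # bs1" cs g f]
        by (simp add: ss Nil bs1 mloosen_left_apply mcomp_apply[of \<Gamma> _ _ Loose r "[]" "b # bs1" cs] 1 2 seg_def[of 0])
    next
      case (Cons a as1)
      have "\<forall>Q\<in>set (as1 @ bs @ cs). bimodule K Q" using bim Cons by auto
      with D[unfolded Cons, simplified]
      obtain A ss' M Ms' where ss: "ss = Mid A # ss'" "Ms = M # Ms'" "ss' \<noteq> []" "A \<in> XX K" "\<Gamma> \<in> Ob K"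
        and D': "(\<Gamma> \<otimes> jj K A, Start # ss', M # act_args K (as1 @ bs @ cs) (Pr1 K \<Gamma> (jj K A)) ss' Ms')
        \<in> multimap_dom K Tight r (a # as1 @ bs @ cs)"
        by (rule multimap_dom_Loose_Cons)
      have len: "length ss' = Suc (length (as1 @ bs @ cs))" "length Ms' = length (as1 @ bs @ cs)"
        using multimap_dom_length[OF D] by (auto simp: ss Cons)
      have pr: "Pr1 K \<Gamma> (jj K A) \<in> arrows K (\<Gamma> \<otimes> jj K A) \<Gamma>" using ss by (simp add: Pr1_arrows)
      \<comment> \<open>Naturality of \<open>f\<close> along the projection exchanges evaluation
        with weakening.\<close>
      have "f (\<Gamma> \<otimes> jj K A) (seg (length as1) (Suc (length bs)) ss')
          (seg (length as1) (length bs) (act_args K (as1 @ bs @ cs) (Pr1 K \<Gamma> (jj K A)) ss' Ms'))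
        = act x (trg K (ss' ! (length as1 + length bs))) (ctx_map K (Pr1 K \<Gamma> (jj K A)) (ss' ! length as1))
            (f \<Gamma> (seg (length as1) (Suc (length bs)) ss') (seg (length as1) (length bs) Ms'))"
        using multimaps_natural[OF f' pr, of "seg (length as1) (Suc (length bs)) ss'" "seg (length as1) (length bs) Ms'"]
          Df len by (simp add: act_args_seg[OF len] ss Cons hd_seg last_seg)
      then show ?thesis using D D' Dg
        mcomp_apply[of "\<Gamma> \<otimes> jj K A" "Start # ss'" "M # act_args K (as1 @ bs @ cs) (Pr1 K \<Gamma> (jj K A)) ss' Ms'"
          Tight r "a # as1" bs cs g f]
        by (simp add: ss Cons mloosen_left_apply mcomp_apply[of \<Gamma> _ _ Loose r "a # as1" bs cs] act_args_graft[OF len])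
    qed
  qed
  then show ?thesis by (auto simp: fun_eq_iff mloosen_left_def mcomp_eq mrestrict_def)
qed

text \<open>Right-loosening only renames the last stage, and that stage bounds the segment of
  \<open>f\<close> exactly when \<open>cs\<close> is empty. Both cases are computations with
  lists.\<close>

lemma mloosen_right_mcomp:
  assumes "g \<in> mor (bimod_multicat K) l Tight (as @ x # cs) y"
    "f \<in> mor (bimod_multicat K) (inner l as) (inner Tight cs) bs x"
  shows "mloosen_right K l (as @ bs @ cs) (mcomp K l Tight as bs cs g f)
    = mcomp K l Loose as bs cs (mloosen_right K l (as @ x # cs) g)
        (if cs = [] then mloosen_right K (inner l as) bs f else f)"
proof -
  note g = assms(1)[unfolded mor_bimod_iff] and f = assms(2)[unfolded mor_bimod_iff]
  have bs: "bs = [] \<longrightarrow> inner l as = Loose \<and> inner Tight cs = Loose"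
    using f by blast+
  let ?f = "if cs = [] then mloosen_right K (inner l as) bs f else f"
  have fl: "?f \<in> mor (bimod_multicat K) (inner l as) (inner Loose cs) bs x"
    using assms(2) mloosen_right_mor by (auto simp: inner_def)
  have val: "as @ bs @ cs = [] \<longrightarrow> l = Loose \<and> Loose = Loose" using bs by auto
  have bs': "bs = [] \<longrightarrow> inner l as = Loose \<and> inner Loose cs = Loose" using bs by auto
  have "mloosen_right K l (as @ bs @ cs) (mcomp K l Tight as bs cs g f) \<Gamma> ss Ms
      = mcomp K l Loose as bs cs (mloosen_right K l (as @ x # cs) g) ?f \<Gamma> ss Ms"
    if D: "(\<Gamma>, ss, Ms) \<in> multimap_dom K l Loose (as @ bs @ cs)" for \<Gamma> ss Ms
  proof -
    note Dg = graft_dom_multimap(2)[OF D val bs' fl[unfolded mor_bimod_iff, THEN conjunct1]]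
    note Df = seg_dom[OF D val bs']
    have ne: "as @ bs @ cs \<noteq> []" using bs by auto
    obtain A ss' where ss: "ss = ss' @ [Mid A]" "A \<in> XX K" "length ss' = length (as @ bs @ cs)"
      and D': "(\<Gamma>, ss' @ [End (FF K A)], Ms) \<in> multimap_dom K l Tight (as @ bs @ cs)"
      using D ne by (rule multimap_dom_Loose_snoc)
    have len: "length Ms = length (as @ bs @ cs)" using multimap_dom_length[OF D] by simp
    show ?thesis
    proof (cases cs)
      case Nil
      \<comment> \<open>A right-tight \<open>f\<close> has an input; without one, the cut would
        repeat the last stage.\<close>
      then have "bs \<noteq> []" using bs by auto
      then show ?thesis using D D' Dg Df ss(3)
        by (simp add: ss(1) Nil mloosen_right_apply mcomp_apply[of \<Gamma> _ _ l _ as bs "[]", simplified] skip_snoc seg_snoc)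
    next
      case (Cons c cs1)
      then show ?thesis using D D' Dg ss(3)
        by (simp add: ss(1) mloosen_right_apply mcomp_apply skip_snoc seg_snoc)
    qed
  qed
  then show ?thesis by (auto simp: fun_eq_iff mloosen_right_def mcomp_eq mrestrict_def)
qed

section \<open>Identity laws\<close>

lemma ident_at_bimod:
  assumes "bimodule K Q"
  shows "ident_at (bimod_multicat K) l r Q = mrestrict K l r [Q] (\<lambda>\<Gamma> ss Ms. hd Ms)"
proof -
  \<comment> \<open>The only argument is the first one, which left-loosening leaves
    unchanged.\<close>
  have L: "mloosen_left K r [Q] (mrestrict K Tight r [Q] (\<lambda>\<Gamma> ss Ms. hd Ms)) = mrestrict K Loose r [Q] (\<lambda>\<Gamma> ss Ms. hd Ms)" for r
    unfolding mloosen_left_def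
  proof (rule mrestrict_cong, goal_cases)
    case (1 \<Gamma> ss Ms)
    then show ?case by (rule multimap_dom_Loose_Cons) auto
  qed
  have R: "mloosen_right K l [Q] (mrestrict K l Tight [Q] (\<lambda>\<Gamma> ss Ms. hd Ms)) = mrestrict K l Loose [Q] (\<lambda>\<Gamma> ss Ms. hd Ms)" for l
    unfolding mloosen_right_def
  proof (rule mrestrict_cong, goal_cases)
    case (1 \<Gamma> ss Ms)
    then show ?case by (rule multimap_dom_Loose_snoc) auto
  qed
  show ?thesis
    by (cases l; cases r; simp add: bimod_multicat_def mident_def L R)
qed

text \<open>A cut with \<open>q = 1\<close> is trivial: \<open>skip\<close> keeps the whole list,
  and \<open>graft\<close> puts back the entry that was taken out.\<close>

lemma mcomp_ident:
  assumes "g \<in> mor (bimod_multicat K) l r (as @ x # cs) y"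
  shows "mcomp K l r as [x] cs g (ident_at (bimod_multicat K) (inner l as) (inner r cs) x) = g"
proof -
  note g = assms[unfolded mor_bimod_iff]
  then have x: "bimodule K x" and g': "g \<in> multimaps K l r (as @ [x] @ cs) y" by auto
  show ?thesis
    unfolding mcomp_eq using g'
  proof (rule mrestrict_eqI)
    fix \<Gamma> ss Ms assume D: "(\<Gamma>, ss, Ms) \<in> multimap_dom K l r (as @ [x] @ cs)"
    have D': "(\<Gamma>, seg (length as) (Suc (length [x])) ss, seg (length as) (length [x]) Ms) \<in> multimap_dom K (inner l as) (inner r cs) [x]"
      using D by (rule seg_dom) auto
    have len: "length as < length Ms" using multimap_dom_length[OF D] by simp
    have "skip (length as) (Suc 0) ss = ss" by (simp add: skip_def)
    moreover have "hd (seg (length as) (Suc 0) Ms) = Ms ! length as" using len by (rule hd_seg)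
    moreover have "graft (length as) (Suc 0) (Ms ! length as) Ms = Ms"
      using len by (simp add: graft_def id_take_nth_drop[symmetric])
    ultimately show "g \<Gamma> (skip (length as) (length [x]) ss) (graft (length as) (length [x])
       (ident_at (bimod_multicat K) (inner l as) (inner r cs) x \<Gamma>
         (seg (length as) (Suc (length [x])) ss) (seg (length as) (length [x]) Ms)) Ms) = g \<Gamma> ss Ms"
      using D' by (simp add: ident_at_bimod[OF x])
  qed
qed

lemma ident_mcomp:
  assumes "f \<in> mor (bimod_multicat K) l r bs x"
  shows "mcomp K l r [] bs [] (ident_at (bimod_multicat K) l r x) f = f"
proof -
  note f = assms[unfolded mor_bimod_iff]
  then have x: "bimodule K x" and f': "f \<in> multimaps K l r ([] @ bs @ []) x" by auto
  show ?thesis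
    unfolding mcomp_eq using f'
  proof (rule mrestrict_eqI)
    fix \<Gamma> ss Ms assume D: "(\<Gamma>, ss, Ms) \<in> multimap_dom K l r ([] @ bs @ [])"
    note len = multimap_dom_length[OF D]
    have "(\<Gamma>, skip (length []) (length bs) ss, graft (length []) (length bs)
         (f \<Gamma> (seg (length []) (Suc (length bs)) ss) (seg (length []) (length bs) Ms)) Ms)
      \<in> multimap_dom K l r ([] @ [x])"
      using graft_dom_multimap(2)[of \<Gamma> ss Ms K l r "[]" bs "[]" f x] D f by simp
    then show "ident_at (bimod_multicat K) l r x \<Gamma> (skip (length []) (length bs) ss) (graft (length []) (length bs)
         (f \<Gamma> (seg (length []) (Suc (length bs)) ss) (seg (length []) (length bs) Ms)) Ms) = f \<Gamma> ss Ms"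
      using len by (simp add: ident_at_bimod[OF x] seg_def)
  qed
qed

section \<open>Associativity and interchange\<close>

lemma mcomp_assoc:
  assumes "h \<in> mor (bimod_multicat K) l r (as @ y # es) z"
    "g \<in> mor (bimod_multicat K) (inner l as) (inner r es) (bs @ x # ds) y"
    "f \<in> mor (bimod_multicat K) (inner l (as @ bs)) (inner r (ds @ es)) cs x"
  shows "mcomp K l r as (bs @ cs @ ds) es h (mcomp K (inner l as) (inner r es) bs cs ds g f)
    = mcomp K l r (as @ bs) cs (ds @ es) (mcomp K l r as (bs @ x # ds) es h g) f"
proof -
  have f': "f \<in> multimaps K (inner l (as @ bs)) (inner r (ds @ es)) cs x"
    and g': "g \<in> multimaps K (inner l as) (inner r es) (bs @ x # ds) y"
    using assms by (auto simp: mor_bimod_iff)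
  have cs: "cs = [] \<longrightarrow> inner l (as @ bs) = Loose \<and> inner r (ds @ es) = Loose"
    using assms(3) by (auto simp: mor_bimod_iff)
  have val: "(as @ bs) @ cs @ (ds @ es) = [] \<longrightarrow> l = Loose \<and> r = Loose" using cs by auto
  have val2: "as @ (bs @ cs @ ds) @ es = [] \<longrightarrow> l = Loose \<and> r = Loose" using cs by auto
  \<comment> \<open>If the middle list is empty, so are \<open>bs\<close>, \<open>cs\<close> and
    \<open>ds\<close>, and the conditions known for an empty \<open>cs\<close> become those
    required.\<close>
  have bcd: "bs @ cs @ ds = [] \<longrightarrow> inner l as = Loose \<and> inner r es = Loose" using cs by auto
  show ?thesis
    unfolding mcomp_eq[of K l r "as @ bs"] mcomp_eq[of K l r as "bs @ cs @ ds"] append.assoc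
  proof (rule mrestrict_cong)
    fix \<Gamma> ss Ms assume "(\<Gamma>, ss, Ms) \<in> multimap_dom K l r (as @ bs @ cs @ ds @ es)"
    then have D: "(\<Gamma>, ss, Ms) \<in> multimap_dom K l r ((as @ bs) @ cs @ (ds @ es))"
      and D2: "(\<Gamma>, ss, Ms) \<in> multimap_dom K l r (as @ (bs @ cs @ ds) @ es)" by simp_all
    have Ds: "(\<Gamma>, seg (length as) (Suc (length (bs @ cs @ ds))) ss, seg (length as) (length (bs @ cs @ ds)) Ms)
      \<in> multimap_dom K (inner l as) (inner r es) (bs @ cs @ ds)"
      using D2 val2 bcd by (rule seg_dom)
    have Dg: "(\<Gamma>, skip (length (as @ bs)) (length cs) ss, graft (length (as @ bs)) (length cs)
        (f \<Gamma> (seg (length (as @ bs)) (Suc (length cs)) ss) (seg (length (as @ bs)) (length cs) Ms)) Ms)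
      \<in> multimap_dom K l r (as @ (bs @ x # ds) @ es)"
      using graft_dom_multimap(2)[OF D val cs f'] by simp
    have "length as + length bs + length cs + length ds < length ss"
      "length as + length bs + length cs + length ds \<le> length Ms"
      using multimap_dom_length[OF D] by auto
    note lens = skip_skip[OF this(1)] seg_skip[OF this(1)] seg_graft[OF this(2)] graft_graft[OF this(2)]
    show "h \<Gamma> (skip (length as) (length (bs @ cs @ ds)) ss) (graft (length as) (length (bs @ cs @ ds))
           (mcomp K (inner l as) (inner r es) bs cs ds g f \<Gamma>
             (seg (length as) (Suc (length (bs @ cs @ ds))) ss) (seg (length as) (length (bs @ cs @ ds)) Ms)) Ms)
      = mcomp K l r as (bs @ x # ds) es h g \<Gamma> (skip (length (as @ bs)) (length cs) ss)
          (graft (length (as @ bs)) (length cs)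
            (f \<Gamma> (seg (length (as @ bs)) (Suc (length cs)) ss) (seg (length (as @ bs)) (length cs) Ms)) Ms)"
      unfolding mcomp_apply[OF Ds] mcomp_apply[OF Dg]
      by (simp add: seg_seg lens add.assoc[symmetric])
  qed
qed

lemma mcomp_interchange:
  assumes "h \<in> mor (bimod_multicat K) l r (as @ x # bs @ y # cs) z"
    "f \<in> mor (bimod_multicat K) (inner l as) Loose ds x"
    "g \<in> mor (bimod_multicat K) Loose (inner r cs) es y"
  shows "mcomp K l r (as @ ds @ bs) es cs (mcomp K l r as ds (bs @ y # cs) h f) g
    = mcomp K l r as ds (bs @ es @ cs) (mcomp K l r (as @ x # bs) es cs h g) f"
proof -
  have ds: "ds = [] \<longrightarrow> inner l as = Loose" and es: "es = [] \<longrightarrow> inner r cs = Loose"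
    using assms by (auto simp: mor_bimod_iff)
  \<comment> \<open>Substituting a nullary \<open>g\<close> can make \<open>f\<close> the last
    input. Being nullary forces \<open>r\<close> to be loose if \<open>cs\<close> is empty, so
    \<open>f\<close> keeps its right-loose type; symmetrically for \<open>g\<close> on the
    left.\<close>
  have inner: "inner r (bs @ es @ cs) = Loose" "inner l (as @ ds @ bs) = Loose"
    using ds es by (auto simp: inner_def split: if_splits)
  have f': "f \<in> multimaps K (inner l as) (inner r (bs @ es @ cs)) ds x"
    and g': "g \<in> multimaps K (inner l (as @ ds @ bs)) (inner r cs) es y"
    using assms inner by (auto simp: mor_bimod_iff)
  have ds': "ds = [] \<longrightarrow> inner l as = Loose \<and> inner r (bs @ es @ cs) = Loose"
    and es': "es = [] \<longrightarrow> inner l (as @ ds @ bs) = Loose \<and> inner r cs = Loose"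
    using ds es inner by auto
  have val: "as @ ds @ (bs @ es @ cs) = [] \<longrightarrow> l = Loose \<and> r = Loose"
    "(as @ ds @ bs) @ es @ cs = [] \<longrightarrow> l = Loose \<and> r = Loose"
    using ds es by auto
  show ?thesis
    unfolding mcomp_eq[of K l r "as @ ds @ bs"] mcomp_eq[of K l r as ds "bs @ es @ cs"] append.assoc
  proof (rule mrestrict_cong)
    fix \<Gamma> ss Ms assume "(\<Gamma>, ss, Ms) \<in> multimap_dom K l r (as @ ds @ bs @ es @ cs)"
    then have D: "(\<Gamma>, ss, Ms) \<in> multimap_dom K l r (as @ ds @ (bs @ es @ cs))"
      and D2: "(\<Gamma>, ss, Ms) \<in> multimap_dom K l r ((as @ ds @ bs) @ es @ cs)" by simp_all
    have Df: "(\<Gamma>, skip (length as) (length ds) ss, graft (length as) (length ds)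
        (f \<Gamma> (seg (length as) (Suc (length ds)) ss) (seg (length as) (length ds) Ms)) Ms)
      \<in> multimap_dom K l r ((as @ x # bs) @ es @ cs)"
      using graft_dom_multimap(2)[OF D val(1) ds' f'] by simp
    have Dg: "(\<Gamma>, skip (length (as @ ds @ bs)) (length es) ss, graft (length (as @ ds @ bs)) (length es)
        (g \<Gamma> (seg (length (as @ ds @ bs)) (Suc (length es)) ss) (seg (length (as @ ds @ bs)) (length es) Ms)) Ms)
      \<in> multimap_dom K l r (as @ ds @ (bs @ y # cs))"
      using graft_dom_multimap(2)[OF D2 val(2) es' g'] by simp
    have "length as + length ds + length bs + length es < length ss"
      "length as + length ds + length bs + length es \<le> length Ms"
      using multimap_dom_length[OF D] by auto
    note lens = skip_commute[OF this(1)] seg_skip_before[OF this(1)] seg_skip_after[OF this(1)]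
      seg_graft_before[OF this(2)] seg_graft_after[OF this(2)] graft_commute[OF this(2)]
    show "mcomp K l r as ds (bs @ y # cs) h f \<Gamma> (skip (length (as @ ds @ bs)) (length es) ss)
        (graft (length (as @ ds @ bs)) (length es)
          (g \<Gamma> (seg (length (as @ ds @ bs)) (Suc (length es)) ss) (seg (length (as @ ds @ bs)) (length es) Ms)) Ms)
      = mcomp K l r (as @ x # bs) es cs h g \<Gamma> (skip (length as) (length ds) ss)
        (graft (length as) (length ds)
          (f \<Gamma> (seg (length as) (Suc (length ds)) ss) (seg (length as) (length ds) Ms)) Ms)"
      unfolding mcomp_apply[OF Df] mcomp_apply[OF Dg]
      by (simp add: lens add.assoc[symmetric])
  qed
qed

lemma bi_skew_multicategory_bimod: "bi_skew_multicategory (bimod_multicat K)"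
proof
  let ?S = "bimod_multicat K"
  \<comment> \<open>The operations are unfolded through these equations while \<open>mor\<close>
    keeps \<open>bimod_multicat K\<close> folded, so that the goals match the lemmas above.\<close>
  have sel: "LLoosen ?S r Qs \<Omega> = mloosen_left K r Qs" "RLoosen ?S l Qs \<Omega> = mloosen_right K l Qs"
    "Ident ?S = mident K" "Comp ?S l r as x cs y bs = mcomp K l r as bs cs" "Objs ?S = {Q. bimodule K Q}"
    for l r Qs \<Omega> as x cs y bs by (simp_all add: bimod_multicat_def)
  show "f \<in> mor ?S Tight r as y \<Longrightarrow> LLoosen ?S r as y f \<in> mor ?S Loose r as y" for f r as y
    unfolding sel by (rule mloosen_left_mor)
  show "f \<in> mor ?S l Tight as y \<Longrightarrow> RLoosen ?S l as y f \<in> mor ?S l Loose as y" for f l as y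
    unfolding sel by (rule mloosen_right_mor)
  show "x \<in> Objs ?S \<Longrightarrow> Ident ?S x \<in> mor ?S Tight Tight [x] x" for x
    unfolding sel by (rule mident_mor) simp
  show "g \<in> mor ?S l r (as @ x # cs) y \<Longrightarrow> f \<in> mor ?S (inner l as) (inner r cs) bs x
      \<Longrightarrow> Comp ?S l r as x cs y bs g f \<in> mor ?S l r (as @ bs @ cs) y" for g l r as x cs y f bs
    unfolding sel by (rule mcomp_mor)
  show "f \<in> mor ?S Tight Tight as y
      \<Longrightarrow> RLoosen ?S Loose as y (LLoosen ?S Tight as y f) = LLoosen ?S Loose as y (RLoosen ?S Tight as y f)" for f as y
    unfolding sel by (rule mloosen_commute)
  show "g \<in> mor ?S Tight r (as @ x # cs) y \<Longrightarrow> f \<in> mor ?S (inner Tight as) (inner r cs) bs x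
      \<Longrightarrow> LLoosen ?S r (as @ bs @ cs) y (Comp ?S Tight r as x cs y bs g f)
        = Comp ?S Loose r as x cs y bs (LLoosen ?S r (as @ x # cs) y g)
            (if as = [] then LLoosen ?S (inner r cs) bs x f else f)" for g r as x cs y f bs
    unfolding sel by (rule mloosen_left_mcomp)
  show "g \<in> mor ?S l Tight (as @ x # cs) y \<Longrightarrow> f \<in> mor ?S (inner l as) (inner Tight cs) bs x
      \<Longrightarrow> RLoosen ?S l (as @ bs @ cs) y (Comp ?S l Tight as x cs y bs g f)
        = Comp ?S l Loose as x cs y bs (RLoosen ?S l (as @ x # cs) y g)
            (if cs = [] then RLoosen ?S (inner l as) bs x f else f)" for g l as x cs y f bs
    unfolding sel by (rule mloosen_right_mcomp)
  show "g \<in> mor ?S l r (as @ x # cs) y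
      \<Longrightarrow> Comp ?S l r as x cs y [x] g (ident_at ?S (inner l as) (inner r cs) x) = g" for g l r as x cs y
    unfolding sel by (rule mcomp_ident)
  show "f \<in> mor ?S l r bs x \<Longrightarrow> Comp ?S l r [] x [] x bs (ident_at ?S l r x) f = f" for f l r bs x
    unfolding sel by (rule ident_mcomp)
  show "h \<in> mor ?S l r (as @ y # es) z \<Longrightarrow> g \<in> mor ?S (inner l as) (inner r es) (bs @ x # ds) y \<Longrightarrow>
        f \<in> mor ?S (inner l (as @ bs)) (inner r (ds @ es)) cs x
      \<Longrightarrow> Comp ?S l r as y es z (bs @ cs @ ds) h
            (Comp ?S (inner l as) (inner r es) bs x ds y cs g f)
        = Comp ?S l r (as @ bs) x (ds @ es) z cs
            (Comp ?S l r as y es z (bs @ x # ds) h g) f" for h l r as y es z g bs x ds f cs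
    unfolding sel by (rule mcomp_assoc)
  show "h \<in> mor ?S l r (as @ x # bs @ y # cs) z \<Longrightarrow> f \<in> mor ?S (inner l as) Loose ds x \<Longrightarrow>
        g \<in> mor ?S Loose (inner r cs) es y
      \<Longrightarrow> Comp ?S l r (as @ ds @ bs) y cs z es (Comp ?S l r as x (bs @ y # cs) z ds h f) g
        = Comp ?S l r as x (bs @ es @ cs) z ds (Comp ?S l r (as @ x # bs) y cs z es h g) f"
    for h l r as x bs y cs z f ds g es
    unfolding sel by (rule mcomp_interchange)
qed

end

section \<open>Monoids and RetSeq models\<close>

lemmas multimap_dom_explicit = multimap_dom_iff stage_at_iff all_le_Suc All_less_Suc2

lemma all_multimap_dom_unit:
  "(\<forall>\<Gamma> ss Ms. (\<Gamma>, ss, Ms) \<in> multimap_dom K Loose Loose [] \<longrightarrow> P \<Gamma> ss Ms) \<longleftrightarrow>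
    (\<forall>\<Gamma>\<in>Ob K. \<forall>A\<in>XX K. P \<Gamma> [Mid A] [])"
  by (auto simp: multimap_dom_explicit length_Suc_conv)

lemma all_multimap_dom_Loose_Tight:
  "(\<forall>\<Gamma> ss Ms. (\<Gamma>, ss, Ms) \<in> multimap_dom K Loose Tight [Q] \<longrightarrow> P \<Gamma> ss Ms) \<longleftrightarrow>
    (\<forall>\<Gamma>\<in>Ob K. \<forall>A\<in>XX K. \<forall>B\<in>YY K. \<forall>N\<in>car Q (\<Gamma> \<otimes>\<^bsub>K\<^esub> jj K A) B. P \<Gamma> [Mid A, End B] [N])"
  by (auto simp: multimap_dom_explicit length_Suc_conv)

lemma all_multimap_dom_Tight_Loose:
  "(\<forall>\<Gamma> ss Ms. (\<Gamma>, ss, Ms) \<in> multimap_dom K Tight Loose [Q] \<longrightarrow> P \<Gamma> ss Ms) \<longleftrightarrow>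
    (\<forall>\<Gamma>\<in>Ob K. \<forall>A\<in>XX K. \<forall>M\<in>car Q \<Gamma> (FF K A). P \<Gamma> [Start, Mid A] [M])"
  by (auto simp: multimap_dom_explicit length_Suc_conv)

lemma all_multimap_dom_binary:
  "(\<forall>\<Gamma> ss Ms. (\<Gamma>, ss, Ms) \<in> multimap_dom K Tight Tight [Q, Q] \<longrightarrow> P \<Gamma> ss Ms) \<longleftrightarrow>
    (\<forall>\<Gamma>\<in>Ob K. \<forall>A\<in>XX K. \<forall>B\<in>YY K. \<forall>M\<in>car Q \<Gamma> (FF K A). \<forall>N\<in>car Q (\<Gamma> \<otimes>\<^bsub>K\<^esub> jj K A) B.
      P \<Gamma> [Start, Mid A, End B] [M, N])"
  by (auto simp: multimap_dom_explicit length_Suc_conv)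

lemma all_multimap_dom_ternary:
  "(\<forall>\<Gamma> ss Ms. (\<Gamma>, ss, Ms) \<in> multimap_dom K Tight Tight [Q, Q, Q] \<longrightarrow> P \<Gamma> ss Ms) \<longleftrightarrow>
    (\<forall>\<Gamma>\<in>Ob K. \<forall>A\<in>XX K. \<forall>A'\<in>XX K. \<forall>B\<in>YY K. \<forall>M\<in>car Q \<Gamma> (FF K A).
      \<forall>N\<in>car Q (\<Gamma> \<otimes>\<^bsub>K\<^esub> jj K A) (FF K A'). \<forall>P'\<in>car Q (\<Gamma> \<otimes>\<^bsub>K\<^esub> jj K A') B.
      P \<Gamma> [Start, Mid A, Mid A', End B] [M, N, P'])"
  by (auto simp: multimap_dom_explicit length_Suc_conv)

text \<open>Typing and naturality are gathered under a single quantification over indices, the form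
  that the enumerations above rewrite.\<close>

lemma multimaps_iff:
  "\<phi> \<in> multimaps K l r Qs \<Omega> \<longleftrightarrow>
    (\<forall>\<Gamma> ss Ms. (\<Gamma>, ss, Ms) \<in> multimap_dom K l r Qs \<longrightarrow>
      \<phi> \<Gamma> ss Ms \<in> car \<Omega> (ctx K \<Gamma> (hd ss)) (trg K (last ss)) \<and>
      (\<forall>\<Delta>. \<forall>\<sigma>\<in>arrows K \<Delta> \<Gamma>. \<phi> \<Delta> ss (act_args K Qs \<sigma> ss Ms)
        = act \<Omega> (trg K (last ss)) (ctx_map K \<sigma> (hd ss)) (\<phi> \<Gamma> ss Ms))) \<and>
    (\<forall>\<Gamma> ss Ms. (\<Gamma>, ss, Ms) \<notin> multimap_dom K l r Qs \<longrightarrow> \<phi> \<Gamma> ss Ms = undefined)"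
  unfolding multimaps_def by blast

lemma mrestrict_eq_iff:
  "mrestrict K l r Qs \<phi> = mrestrict K l r Qs \<psi> \<longleftrightarrow>
    (\<forall>\<Gamma> ss Ms. (\<Gamma>, ss, Ms) \<in> multimap_dom K l r Qs \<longrightarrow> \<phi> \<Gamma> ss Ms = \<psi> \<Gamma> ss Ms)"
  by (auto simp: mrestrict_def fun_eq_iff)

definition mult_seq :: "('o, 'x, 'y, 'e) multimap \<Rightarrow> 'o \<Rightarrow> 'x \<Rightarrow> 'y \<Rightarrow> 'e \<Rightarrow> 'e \<Rightarrow> 'e" where
  "mult_seq m \<Gamma> A B M N = m \<Gamma> [Start, Mid A, End B] [M, N]"

definition unit_ret :: "('o, 'm, 'x, 'y) base \<Rightarrow> ('o, 'm, 'y, 'e) bimodule \<Rightarrow> ('o, 'x, 'y, 'e) multimap \<Rightarrow>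
    'o \<Rightarrow> 'x \<Rightarrow> 'm \<Rightarrow> 'e" where
  "unit_ret K Q e \<Gamma> A V = (if A \<in> XX K \<and> V \<in> arrows K \<Gamma> (jj K A)
     then act Q (FF K A) (pairing K (Id K \<Gamma>) V) (e \<Gamma> [Mid A] []) else undefined)"

context plain_cartesian_base
begin

lemma car_Ob: "bimodule K Q \<Longrightarrow> M \<in> car Q \<Gamma> B \<Longrightarrow> \<Gamma> \<in> Ob K \<and> B \<in> YY K"
  using bimodule.car_empty by fastforce

section \<open>Graphs and weakening\<close>

lemma pairing_Id:
  assumes "V \<in> arrows K \<Gamma> x"
  shows "pairing K (Id K \<Gamma>) V \<in> arrows K \<Gamma> (\<Gamma> \<otimes> x)"
    "pairing K (Id K \<Gamma>) V ;; Pr1 K \<Gamma> x = Id K \<Gamma>" "pairing K (Id K \<Gamma>) V ;; Pr2 K \<Gamma> x = V"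
  using pairing[OF Id_arrows assms] arrows_Ob[OF assms] by auto

text \<open>Both sides are \<open>\<langle>\<sigma>, \<sigma>; V\<rangle>\<close>. This is what
  makes the return operation defined from \<open>e\<close> natural.\<close>

lemma pairing_Id_natural:
  assumes "\<sigma> \<in> arrows K \<Delta> \<Gamma>" "V \<in> arrows K \<Gamma> x"
  shows "\<sigma> ;; pairing K (Id K \<Gamma>) V = pairing K (Id K \<Delta>) (\<sigma> ;; V) ;; prod_map K \<sigma> (Id K x)"
proof -
  have Ob: "\<Gamma> \<in> Ob K" "\<Delta> \<in> Ob K" "x \<in> Ob K" using assms arrows_Ob by auto
  have c: "\<sigma> ;; V \<in> arrows K \<Delta> x" using assms by (rule Cmp_arrows)
  have "\<sigma> ;; pairing K (Id K \<Gamma>) V = pairing K \<sigma> (\<sigma> ;; V)"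
    using Cmp_pairing[OF assms(1) Id_arrows assms(2)] Id_right[OF assms(1)] Ob by simp
  also have "\<dots> = pairing K (Id K \<Delta>) (\<sigma> ;; V) ;; prod_map K \<sigma> (Id K x)"
    using pairing_prod_map[OF Id_arrows c assms(1) Id_arrows] Id_left[OF assms(1)] Id_right[OF c] Ob by simp
  finally show ?thesis .
qed

text \<open>The graph of \<open>V\<close> is a section of \<pi>. Hence every element over
  \<open>\<Gamma> \<times> y\<close> is a pullback of its own weakening.\<close>

lemma prod_map_pairing_Id_Pr1:
  assumes "V \<in> arrows K \<Gamma> x" "y \<in> Ob K"
  shows "prod_map K (pairing K (Id K \<Gamma>) V) (Id K y) ;; prod_map K (Pr1 K \<Gamma> x) (Id K y) = Id K (\<Gamma> \<otimes> y)"
proof -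
  have Ob: "\<Gamma> \<in> Ob K" "x \<in> Ob K" using assms arrows_Ob by auto
  show ?thesis
    using prod_map_Cmp_Id[OF pairing_Id(1)[OF assms(1)] Pr1_arrows[OF Ob] assms(2)]
      pairing_Id(2)[OF assms(1)] prod_map_Id[OF Ob(1) assms(2)] by simp
qed

text \<open>Both sides are \<open>\<langle>\<pi>, \<pi>'\<rangle>\<close>. The diagonal on the
  second factor cancels the weakening that naturality along \<pi> introduces.\<close>

lemma pairing_Id_Pr2:
  assumes "\<Gamma> \<in> Ob K" "x \<in> Ob K"
  shows "pairing K (Id K (\<Gamma> \<otimes> x)) (Pr2 K \<Gamma> x) ;; prod_map K (Pr1 K \<Gamma> x) (Id K x) = Id K (\<Gamma> \<otimes> x)"
proof -
  note pr = Pr1_arrows[OF assms] Pr2_arrows[OF assms] and I = Id_arrows[OF Prd_Ob[OF assms]]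
  have "pairing K (Id K (\<Gamma> \<otimes> x)) (Pr2 K \<Gamma> x) ;; prod_map K (Pr1 K \<Gamma> x) (Id K x) = pairing K (Pr1 K \<Gamma> x) (Pr2 K \<Gamma> x)"
    using pairing_prod_map[OF I pr(2) pr(1) Id_arrows[OF assms(2)]] Id_left[OF pr(1)] Id_right[OF pr(2)] by simp
  also have "\<dots> = Id K (\<Gamma> \<otimes> x)"
    using pairing_eqI[OF pr I] Id_left[OF pr(1)] Id_left[OF pr(2)] by simp
  finally show ?thesis .
qed

section \<open>Monoid laws in components\<close>

lemma multimaps_mult_iff:
  "m \<in> multimaps K Tight Tight [Q, Q] Q \<longleftrightarrow>
    (\<forall>\<Gamma>\<in>Ob K. \<forall>A\<in>XX K. \<forall>B\<in>YY K. \<forall>M\<in>car Q \<Gamma> (FF K A). \<forall>N\<in>car Q (\<Gamma> \<otimes> jj K A) B.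
      mult_seq m \<Gamma> A B M N \<in> car Q \<Gamma> B \<and>
      (\<forall>\<Delta>. \<forall>\<sigma>\<in>arrows K \<Delta> \<Gamma>. mult_seq m \<Delta> A B (act Q (FF K A) \<sigma> M) (act Q B (prod_map K \<sigma> (Id K (jj K A))) N)
        = act Q B \<sigma> (mult_seq m \<Gamma> A B M N))) \<and>
    (\<forall>\<Gamma> ss Ms. (\<Gamma>, ss, Ms) \<notin> multimap_dom K Tight Tight [Q, Q] \<longrightarrow> m \<Gamma> ss Ms = undefined)"
  unfolding multimaps_iff all_multimap_dom_binary by (simp add: mult_seq_def)

lemma multimaps_unit_iff:
  "e \<in> multimaps K Loose Loose [] Q \<longleftrightarrow>
    (\<forall>\<Gamma>\<in>Ob K. \<forall>A\<in>XX K. e \<Gamma> [Mid A] [] \<in> car Q (\<Gamma> \<otimes> jj K A) (FF K A) \<and>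
      (\<forall>\<Delta>. \<forall>\<sigma>\<in>arrows K \<Delta> \<Gamma>. e \<Delta> [Mid A] []
        = act Q (FF K A) (prod_map K \<sigma> (Id K (jj K A))) (e \<Gamma> [Mid A] []))) \<and>
    (\<forall>\<Gamma> ss Ms. (\<Gamma>, ss, Ms) \<notin> multimap_dom K Loose Loose [] \<longrightarrow> e \<Gamma> ss Ms = undefined)"
  unfolding multimaps_iff all_multimap_dom_unit by simp

text \<open>This is the origin of the factor \<open>\<pi> \<times> jB\<close> in the associativity
  law of RetSeq models.\<close>

lemma mloosen_left_mult:
  assumes "\<Gamma> \<in> Ob K" "A \<in> XX K" "A' \<in> XX K" "B \<in> YY K"
    "N \<in> car Q (\<Gamma> \<otimes> jj K A) (FF K A')" "P \<in> car Q (\<Gamma> \<otimes> jj K A') B"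
  shows "mloosen_left K Tight [Q, Q] m \<Gamma> [Mid A, Mid A', End B] [N, P]
    = mult_seq m (\<Gamma> \<otimes> jj K A) A' B N (act Q B (prod_map K (Pr1 K \<Gamma> (jj K A)) (Id K (jj K A'))) P)"
  using assms by (subst mloosen_left_apply) (auto simp: multimap_dom_explicit mult_seq_def)

lemma mloosen_right_mult:
  assumes "\<Gamma> \<in> Ob K" "A \<in> XX K" "A' \<in> XX K" "M \<in> car Q \<Gamma> (FF K A)" "N \<in> car Q (\<Gamma> \<otimes> jj K A) (FF K A')"
  shows "mloosen_right K Tight [Q, Q] m \<Gamma> [Start, Mid A, Mid A'] [M, N] = mult_seq m \<Gamma> A (FF K A') M N"
  using assms mloosen_right_apply[of \<Gamma> "[Start, Mid A]" A' "[M, N]" Tight "[Q, Q]" m]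
  by (auto simp: multimap_dom_explicit mult_seq_def)

text \<open>The unit is nullary, so the cut yields the stages \<open>Mid A, Mid A, End B\<close>.
  Loosening turns the first into the context \<open>\<Gamma> \<times> jA\<close> and weakens
  \<open>N\<close> along it.\<close>

lemma left_unit_iff:
  assumes "bimodule K Q" "\<And>\<Gamma> A. \<Gamma> \<in> Ob K \<Longrightarrow> A \<in> XX K \<Longrightarrow> e \<Gamma> [Mid A] [] \<in> car Q (\<Gamma> \<otimes> jj K A) (FF K A)"
  shows "mcomp K Loose Tight [] [] [Q] (mloosen_left K Tight [Q, Q] m) e = mloosen_left K Tight [Q] (mident K Q) \<longleftrightarrow>
    (\<forall>\<Gamma>\<in>Ob K. \<forall>A\<in>XX K. \<forall>B\<in>YY K. \<forall>N\<in>car Q (\<Gamma> \<otimes> jj K A) B.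
      mult_seq m (\<Gamma> \<otimes> jj K A) A B (e \<Gamma> [Mid A] []) (act Q B (prod_map K (Pr1 K \<Gamma> (jj K A)) (Id K (jj K A))) N) = N)"
proof -
  have "mloosen_left K Tight [Q] (mident K Q) = mrestrict K Loose Tight [Q] (\<lambda>\<Gamma> ss Ms. hd Ms)"
    using ident_at_bimod[OF assms(1), of Loose Tight] by (simp add: bimod_multicat_def)
  then show ?thesis
    using assms(2) by (simp add: mcomp_eq mrestrict_eq_iff all_multimap_dom_Loose_Tight skip_def seg_def mloosen_left_mult)
qed

text \<open>The repeated stage is now the last one, and right-loosening reads its second copy as the
  target \<open>FF K A\<close>.\<close>

lemma right_unit_iff:
  assumes "bimodule K Q" "\<And>\<Gamma> A. \<Gamma> \<in> Ob K \<Longrightarrow> A \<in> XX K \<Longrightarrow> e \<Gamma> [Mid A] [] \<in> car Q (\<Gamma> \<otimes> jj K A) (FF K A)"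
  shows "mcomp K Tight Loose [Q] [] [] (mloosen_right K Tight [Q, Q] m) e = mloosen_right K Tight [Q] (mident K Q) \<longleftrightarrow>
    (\<forall>\<Gamma>\<in>Ob K. \<forall>A\<in>XX K. \<forall>M\<in>car Q \<Gamma> (FF K A). mult_seq m \<Gamma> A (FF K A) M (e \<Gamma> [Mid A] []) = M)"
proof -
  have "mloosen_right K Tight [Q] (mident K Q) = mrestrict K Tight Loose [Q] (\<lambda>\<Gamma> ss Ms. hd Ms)"
    using ident_at_bimod[OF assms(1), of Tight Loose] by (simp add: bimod_multicat_def)
  then show ?thesis
    using assms(2)
    by (simp add: mcomp_eq mrestrict_eq_iff all_multimap_dom_Tight_Loose skip_def seg_def graft_def mloosen_right_mult)
qed

lemma mult_assoc_iff:
  "mcomp K Tight Tight [] [Q, Q] [Q] m (mloosen_right K Tight [Q, Q] m)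
      = mcomp K Tight Tight [Q] [Q, Q] [] m (mloosen_left K Tight [Q, Q] m) \<longleftrightarrow>
    (\<forall>\<Gamma>\<in>Ob K. \<forall>A\<in>XX K. \<forall>A'\<in>XX K. \<forall>B\<in>YY K. \<forall>M\<in>car Q \<Gamma> (FF K A). \<forall>N\<in>car Q (\<Gamma> \<otimes> jj K A) (FF K A').
      \<forall>P\<in>car Q (\<Gamma> \<otimes> jj K A') B.
      mult_seq m \<Gamma> A' B (mult_seq m \<Gamma> A (FF K A') M N) P = mult_seq m \<Gamma> A B M
        (mult_seq m (\<Gamma> \<otimes> jj K A) A' B N (act Q B (prod_map K (Pr1 K \<Gamma> (jj K A)) (Id K (jj K A'))) P)))"
  by (simp add: mcomp_eq mrestrict_eq_iff all_multimap_dom_ternary skip_def seg_def graft_def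
      mloosen_left_mult mloosen_right_mult) (simp add: mult_seq_def)

lemma monoids_bimod_iff:
  "(Q, m, e) \<in> monoids (bimod_multicat K) \<longleftrightarrow> bimodule K Q \<and>
    m \<in> multimaps K Tight Tight [Q, Q] Q \<and> e \<in> multimaps K Loose Loose [] Q \<and>
    (\<forall>\<Gamma>\<in>Ob K. \<forall>A\<in>XX K. \<forall>B\<in>YY K. \<forall>N\<in>car Q (\<Gamma> \<otimes> jj K A) B.
      mult_seq m (\<Gamma> \<otimes> jj K A) A B (e \<Gamma> [Mid A] []) (act Q B (prod_map K (Pr1 K \<Gamma> (jj K A)) (Id K (jj K A))) N) = N) \<and>
    (\<forall>\<Gamma>\<in>Ob K. \<forall>A\<in>XX K. \<forall>M\<in>car Q \<Gamma> (FF K A). mult_seq m \<Gamma> A (FF K A) M (e \<Gamma> [Mid A] []) = M) \<and>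
    (\<forall>\<Gamma>\<in>Ob K. \<forall>A\<in>XX K. \<forall>A'\<in>XX K. \<forall>B\<in>YY K. \<forall>M\<in>car Q \<Gamma> (FF K A). \<forall>N\<in>car Q (\<Gamma> \<otimes> jj K A) (FF K A').
      \<forall>P\<in>car Q (\<Gamma> \<otimes> jj K A') B.
      mult_seq m \<Gamma> A' B (mult_seq m \<Gamma> A (FF K A') M N) P = mult_seq m \<Gamma> A B M
        (mult_seq m (\<Gamma> \<otimes> jj K A) A' B N (act Q B (prod_map K (Pr1 K \<Gamma> (jj K A)) (Id K (jj K A'))) P)))"
    (is "_ \<longleftrightarrow> ?b \<and> ?m \<and> ?e \<and> ?l \<and> ?r \<and> ?a")
proof -
  have "(Q, m, e) \<in> monoids (bimod_multicat K) \<longleftrightarrow> ?b \<and> ?m \<and> ?e \<and>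
    mcomp K Loose Tight [] [] [Q] (mloosen_left K Tight [Q, Q] m) e = mloosen_left K Tight [Q] (mident K Q) \<and>
    mcomp K Tight Loose [Q] [] [] (mloosen_right K Tight [Q, Q] m) e = mloosen_right K Tight [Q] (mident K Q) \<and>
    mcomp K Tight Tight [] [Q, Q] [Q] m (mloosen_right K Tight [Q, Q] m)
      = mcomp K Tight Tight [Q] [Q, Q] [] m (mloosen_left K Tight [Q, Q] m)"
    by (simp add: monoids_def mor_bimod_iff) (auto simp: bimod_multicat_def)
  moreover have "e \<Gamma> [Mid A] [] \<in> car Q (\<Gamma> \<otimes> jj K A) (FF K A)" if ?e "\<Gamma> \<in> Ob K" "A \<in> XX K" for \<Gamma> A
    using that unfolding multimaps_unit_iff by blast
  ultimately show ?thesis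
    \<comment> \<open>\<open>conj_cong\<close> makes the earlier conjuncts on \<open>Q\<close> and
      \<open>e\<close> available as conditions of the two unit lemmas.\<close>
    by (simp add: left_unit_iff right_unit_iff mult_assoc_iff cong: conj_cong)
qed

section \<open>From monoids to RetSeq models\<close>

lemma mult_seq_undefined:
  assumes "bimodule K Q" "\<And>\<Gamma> ss Ms. (\<Gamma>, ss, Ms) \<notin> multimap_dom K Tight Tight [Q, Q] \<Longrightarrow> m \<Gamma> ss Ms = undefined"
    "A \<notin> XX K \<or> B \<notin> YY K \<or> M \<notin> car Q \<Gamma> (FF K A) \<or> N \<notin> car Q (\<Gamma> \<otimes> jj K A) B"
  shows "mult_seq m \<Gamma> A B M N = undefined"
  unfolding mult_seq_def using assms(3) by (intro assms(2)) (auto simp: multimap_dom_explicit)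

lemma monoid_retseq_model:
  assumes "(Q, m, e) \<in> monoids (bimod_multicat K)"
  shows "retseq_model K Q (unit_ret K Q e) (mult_seq m)"
proof -
  from assms have Q: "bimodule K Q"
    and m: "m \<in> multimaps K Tight Tight [Q, Q] Q" and e: "e \<in> multimaps K Loose Loose [] Q"
    by (simp_all add: monoids_bimod_iff)
  have left: "mult_seq m (\<Gamma> \<otimes> jj K A) A B (e \<Gamma> [Mid A] []) (act Q B (prod_map K (Pr1 K \<Gamma> (jj K A)) (Id K (jj K A))) N) = N"
    if "\<Gamma> \<in> Ob K" "A \<in> XX K" "B \<in> YY K" "N \<in> car Q (\<Gamma> \<otimes> jj K A) B" for \<Gamma> A B N
    using assms that by (simp add: monoids_bimod_iff)
  have right: "mult_seq m \<Gamma> A (FF K A) M (e \<Gamma> [Mid A] []) = M"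
    if "\<Gamma> \<in> Ob K" "A \<in> XX K" "M \<in> car Q \<Gamma> (FF K A)" for \<Gamma> A M
    using assms that by (simp add: monoids_bimod_iff)
  have assoc: "mult_seq m \<Gamma> A' B (mult_seq m \<Gamma> A (FF K A') M N) P = mult_seq m \<Gamma> A B M
        (mult_seq m (\<Gamma> \<otimes> jj K A) A' B N (act Q B (prod_map K (Pr1 K \<Gamma> (jj K A)) (Id K (jj K A'))) P))"
    if "\<Gamma> \<in> Ob K" "A \<in> XX K" "A' \<in> XX K" "B \<in> YY K" "M \<in> car Q \<Gamma> (FF K A)"
      "N \<in> car Q (\<Gamma> \<otimes> jj K A) (FF K A')" "P \<in> car Q (\<Gamma> \<otimes> jj K A') B" for \<Gamma> A A' B M N P
    using assms that by (simp add: monoids_bimod_iff)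
  have m_closed: "mult_seq m \<Gamma> A B M N \<in> car Q \<Gamma> B"
    and m_natural: "\<sigma> \<in> arrows K \<Delta> \<Gamma> \<Longrightarrow>
      mult_seq m \<Delta> A B (act Q (FF K A) \<sigma> M) (act Q B (prod_map K \<sigma> (Id K (jj K A))) N)
        = act Q B \<sigma> (mult_seq m \<Gamma> A B M N)"
    if "A \<in> XX K" "B \<in> YY K" "M \<in> car Q \<Gamma> (FF K A)" "N \<in> car Q (\<Gamma> \<otimes> jj K A) B" for \<Gamma> \<Delta> \<sigma> A B M N
    using m that car_Ob[OF Q that(3)] by (simp_all add: multimaps_mult_iff)
  have e_closed: "e \<Gamma> [Mid A] [] \<in> car Q (\<Gamma> \<otimes> jj K A) (FF K A)" if "\<Gamma> \<in> Ob K" "A \<in> XX K" for \<Gamma> A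
    using e that by (simp add: multimaps_unit_iff)
  have e_natural: "e \<Delta> [Mid A] [] = act Q (FF K A) (prod_map K \<sigma> (Id K (jj K A))) (e \<Gamma> [Mid A] [])"
    if "\<sigma> \<in> arrows K \<Delta> \<Gamma>" "A \<in> XX K" for \<sigma> \<Delta> \<Gamma> A
    using e that arrows_Ob[OF that(1)] unfolding multimaps_unit_iff by blast
  note closed = bimodule.act_closed[OF Q] and Cmp = bimodule.act_Cmp[OF Q] and Id = bimodule.act_Id[OF Q]
  show ?thesis
  proof (intro retseq_model.intro retseq_model_axioms.intro Q)
    fix A V \<Gamma> assume A: "A \<in> XX K" and V: "V \<in> arrows K \<Gamma> (jj K A)"
    have \<Gamma>: "\<Gamma> \<in> Ob K" using V arrows_Ob by blast
    note p = pairing_Id[OF V]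
    show "unit_ret K Q e \<Gamma> A V \<in> car Q \<Gamma> (FF K A)"
      using closed[OF p(1) e_closed[OF \<Gamma> A]] A V by (simp add: unit_ret_def)
    show "unit_ret K Q e \<Delta> A (\<sigma> ;; V) = act Q (FF K A) \<sigma> (unit_ret K Q e \<Gamma> A V)"
      if \<sigma>: "\<sigma> \<in> arrows K \<Delta> \<Gamma>" for \<sigma> \<Delta>
    proof -
      have \<sigma>V: "\<sigma> ;; V \<in> arrows K \<Delta> (jj K A)" using \<sigma> V by (rule Cmp_arrows)
      have "unit_ret K Q e \<Delta> A (\<sigma> ;; V) = act Q (FF K A) (pairing K (Id K \<Delta>) (\<sigma> ;; V)) (e \<Delta> [Mid A] [])"
        using \<sigma>V A by (simp add: unit_ret_def)
      \<comment> \<open>Naturality of \<open>e\<close> replaces \<open>e\<close> at \<Delta> by a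
        pullback of \<open>e\<close> at \<Gamma>, so both sides become actions on the same
        element.\<close>
      also have "\<dots> = act Q (FF K A) (pairing K (Id K \<Delta>) (\<sigma> ;; V) ;; prod_map K \<sigma> (Id K (jj K A))) (e \<Gamma> [Mid A] [])"
        using Cmp[OF pairing_Id(1)[OF \<sigma>V] prod_map(1)[OF \<sigma> Id_arrows] e_closed[OF \<Gamma> A]] e_natural[OF \<sigma> A] A
        by simp
      also have "\<dots> = act Q (FF K A) \<sigma> (act Q (FF K A) (pairing K (Id K \<Gamma>) V) (e \<Gamma> [Mid A] []))"
        using Cmp[OF \<sigma> p(1) e_closed[OF \<Gamma> A]] pairing_Id_natural[OF \<sigma> V] by simp
      finally show ?thesis using A V by (simp add: unit_ret_def)
    qed
    show "mult_seq m \<Gamma> A B (unit_ret K Q e \<Gamma> A V) M = act Q B (pairing K (Id K \<Gamma>) V) M"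
      if B: "B \<in> YY K" and M: "M \<in> car Q (\<Gamma> \<otimes> jj K A) B" for B M
    proof -
      let ?p = "pairing K (Id K \<Gamma>) V"
      have pr: "prod_map K (Pr1 K \<Gamma> (jj K A)) (Id K (jj K A)) \<in> arrows K ((\<Gamma> \<otimes> jj K A) \<otimes> jj K A) (\<Gamma> \<otimes> jj K A)"
        using \<Gamma> A by (intro prod_map Pr1_arrows Id_arrows) auto
      have pp: "prod_map K ?p (Id K (jj K A)) \<in> arrows K (\<Gamma> \<otimes> jj K A) ((\<Gamma> \<otimes> jj K A) \<otimes> jj K A)"
        using p(1) A by (intro prod_map Id_arrows) auto
      let ?N = "act Q B (prod_map K (Pr1 K \<Gamma> (jj K A)) (Id K (jj K A))) M"
      have N: "?N \<in> car Q ((\<Gamma> \<otimes> jj K A) \<otimes> jj K A) B" using closed[OF pr M] .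
      \<comment> \<open>With \<open>M\<close> written as the pullback of its weakening
        \<open>?N\<close>, both arguments of the product are pulled back along \<open>?p\<close>,
        and naturality reduces the claim to the left unit law.\<close>
      have "act Q B (prod_map K ?p (Id K (jj K A))) ?N = M"
        using Cmp[OF pp pr M] prod_map_pairing_Id_Pr1[OF V jj_Ob[OF A]] Id[OF M] by simp
      then have "mult_seq m \<Gamma> A B (unit_ret K Q e \<Gamma> A V) M
        = mult_seq m \<Gamma> A B (act Q (FF K A) ?p (e \<Gamma> [Mid A] [])) (act Q B (prod_map K ?p (Id K (jj K A))) ?N)"
        using A V by (simp add: unit_ret_def)
      also have "\<dots> = act Q B ?p (mult_seq m (\<Gamma> \<otimes> jj K A) A B (e \<Gamma> [Mid A] []) ?N)"
        by (rule m_natural[OF A B e_closed[OF \<Gamma> A] N p(1)])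
      also have "\<dots> = act Q B ?p M" using left[OF \<Gamma> A B M] by simp
      finally show ?thesis .
    qed
  next
    fix A V \<Gamma> assume "A \<notin> XX K \<or> V \<notin> arrows K \<Gamma> (jj K A)"
    then show "unit_ret K Q e \<Gamma> A V = undefined" by (auto simp: unit_ret_def)
  next
    fix A M \<Gamma> assume A: "A \<in> XX K" and M: "M \<in> car Q \<Gamma> (FF K A)"
    have Ob: "\<Gamma> \<in> Ob K" "jj K A \<in> Ob K" using car_Ob[OF Q M] A by auto
    note pr = Pr1_arrows[OF Ob] Pr2_arrows[OF Ob]
    \<comment> \<open>Naturality of \<open>e\<close> along \<pi> moves its value from context
      \<open>\<Gamma> \<times> jA\<close> to \<Gamma>.\<close>
    have "unit_ret K Q e (\<Gamma> \<otimes> jj K A) A (Pr2 K \<Gamma> (jj K A)) = act Q (FF K A)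
      (pairing K (Id K (\<Gamma> \<otimes> jj K A)) (Pr2 K \<Gamma> (jj K A)) ;; prod_map K (Pr1 K \<Gamma> (jj K A)) (Id K (jj K A))) (e \<Gamma> [Mid A] [])"
      using Cmp[OF pairing_Id(1)[OF pr(2)] prod_map(1)[OF pr(1) Id_arrows[OF Ob(2)]] e_closed[OF Ob(1) A]]
        e_natural[OF pr(1) A] A pr(2) by (simp add: unit_ret_def)
    also have "\<dots> = e \<Gamma> [Mid A] []"
      using pairing_Id_Pr2[OF Ob] Id[OF e_closed[OF Ob(1) A]] by simp
    finally show "mult_seq m \<Gamma> A (FF K A) M (unit_ret K Q e (\<Gamma> \<otimes> jj K A) A (Pr2 K \<Gamma> (jj K A))) = M"
      using right[OF Ob(1) A M] by simp
  next
    fix A B M N \<Gamma>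
    show "A \<notin> XX K \<or> B \<notin> YY K \<or> M \<notin> car Q \<Gamma> (FF K A) \<or> N \<notin> car Q (\<Gamma> \<otimes> jj K A) B \<Longrightarrow>
        mult_seq m \<Gamma> A B M N = undefined"
      using Q multimaps_undefined[OF m] by (rule mult_seq_undefined)
  next
    fix A A' B M N P \<Gamma>
    assume "A \<in> XX K" "A' \<in> XX K" "B \<in> YY K" "M \<in> car Q \<Gamma> (FF K A)"
      "N \<in> car Q (\<Gamma> \<otimes> jj K A) (FF K A')" "P \<in> car Q (\<Gamma> \<otimes> jj K A') B"
    then show "mult_seq m \<Gamma> A' B (mult_seq m \<Gamma> A (FF K A') M N) P = mult_seq m \<Gamma> A B M
        (mult_seq m (\<Gamma> \<otimes> jj K A) A' B N (act Q B (prod_map K (Pr1 K \<Gamma> (jj K A)) (Id K (jj K A'))) P))"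
      using car_Ob[OF Q] assoc by blast
  qed (use m_closed m_natural in simp_all)
qed

section \<open>From RetSeq models to monoids\<close>

lemma mult_seq_retseq_mult:
  assumes "retseq_model K Q ret seq"
  shows "mult_seq (retseq_mult K Q seq) = seq"
proof (intro ext)
  fix \<Gamma> A B M N
  interpret retseq_model K Q ret seq by fact
  show "mult_seq (retseq_mult K Q seq) \<Gamma> A B M N = seq \<Gamma> A B M N"
  proof (cases "A \<in> XX K \<and> B \<in> YY K \<and> M \<in> car Q \<Gamma> (FF K A) \<and> N \<in> car Q (\<Gamma> \<otimes> jj K A) B")
    case True
    then have "(\<Gamma>, [Start, Mid A, End B], [M, N]) \<in> multimap_dom K Tight Tight [Q, Q]"
      using car_Ob[OF bimodule_axioms] by (auto simp: multimap_dom_explicit)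
    then show ?thesis by (simp add: mult_seq_def retseq_mult_def)
  next
    case False
    then have "mult_seq (retseq_mult K Q seq) \<Gamma> A B M N = undefined"
      by (intro mult_seq_undefined[OF bimodule_axioms]) (auto simp: retseq_mult_def mrestrict_undefined)
    then show ?thesis using seq_undefined False by auto
  qed
qed

lemma retseq_unit_apply:
  "\<Gamma> \<in> Ob K \<Longrightarrow> A \<in> XX K \<Longrightarrow> retseq_unit K Q ret \<Gamma> [Mid A] [] = ret (\<Gamma> \<otimes> jj K A) A (Pr2 K \<Gamma> (jj K A))"
  by (simp add: retseq_unit_def multimap_dom_explicit)

lemma unit_ret_retseq_unit:
  assumes "retseq_model K Q ret seq"
  shows "unit_ret K Q (retseq_unit K Q ret) = ret"
proof (intro ext)
  fix \<Gamma> A V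
  interpret retseq_model K Q ret seq by fact
  show "unit_ret K Q (retseq_unit K Q ret) \<Gamma> A V = ret \<Gamma> A V"
  proof (cases "A \<in> XX K \<and> V \<in> arrows K \<Gamma> (jj K A)")
    case True
    then have \<Gamma>: "\<Gamma> \<in> Ob K" and V: "V \<in> arrows K \<Gamma> (jj K A)" and A: "A \<in> XX K" using arrows_Ob by auto
    \<comment> \<open>The Yoneda argument: \<open>V\<close> is the pullback of the generic element
      \<pi>' along its own graph.\<close>
    have "ret \<Gamma> A (pairing K (Id K \<Gamma>) V ;; Pr2 K \<Gamma> (jj K A))
      = act Q (FF K A) (pairing K (Id K \<Gamma>) V) (ret (\<Gamma> \<otimes> jj K A) A (Pr2 K \<Gamma> (jj K A)))"
      by (rule ret_natural[OF A pairing_Id(1)[OF V] Pr2_arrows[OF \<Gamma> jj_Ob[OF A]]])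
    then show ?thesis
      using A V \<Gamma> by (simp add: unit_ret_def retseq_unit_apply pairing_Id(3)[OF V])
  next
    case False
    then show ?thesis using ret_undefined by (auto simp: unit_ret_def)
  qed
qed

lemma retseq_model_monoid:
  assumes "retseq_model K Q ret seq"
  shows "(Q, retseq_mult K Q seq, retseq_unit K Q ret) \<in> monoids (bimod_multicat K)"
proof -
  interpret retseq_model K Q ret seq by fact
  have "retseq_mult K Q seq \<in> multimaps K Tight Tight [Q, Q] Q"
    unfolding multimaps_mult_iff mult_seq_retseq_mult[OF assms]
    by (auto simp: seq_closed seq_natural retseq_mult_def mrestrict_undefined)
  moreover have "retseq_unit K Q ret \<in> multimaps K Loose Loose [] Q"
    unfolding multimaps_unit_iff
  proof (intro conjI ballI allI impI)
    fix \<Gamma> A assume \<Gamma>: "\<Gamma> \<in> Ob K" and A: "A \<in> XX K"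
    note pr = Pr2_arrows[OF \<Gamma> jj_Ob[OF A]]
    show "retseq_unit K Q ret \<Gamma> [Mid A] [] \<in> car Q (\<Gamma> \<otimes> jj K A) (FF K A)"
      using ret_closed[OF A pr] \<Gamma> A by (simp add: retseq_unit_apply)
    fix \<Delta> \<sigma> assume \<sigma>: "\<sigma> \<in> arrows K \<Delta> \<Gamma>"
    have \<Delta>: "\<Delta> \<in> Ob K" using arrows_Ob[OF \<sigma>] by simp
    note s = prod_map[OF \<sigma> Id_arrows[OF jj_Ob[OF A]]]
    \<comment> \<open>As \<open>(\<sigma> \<times> jA); \<pi>' = \<pi>'\<close>, the generic element
      is stable under change of context.\<close>
    show "retseq_unit K Q ret \<Delta> [Mid A] []
      = act Q (FF K A) (prod_map K \<sigma> (Id K (jj K A))) (retseq_unit K Q ret \<Gamma> [Mid A] [])"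
      using ret_natural[OF A s(1) pr] s(3) Id_right[OF Pr2_arrows[OF \<Delta> jj_Ob[OF A]]] \<Gamma> \<Delta> A
      by (simp add: retseq_unit_apply)
  qed (simp add: retseq_unit_def mrestrict_undefined)
  moreover have "seq (\<Gamma> \<otimes> jj K A) A B (ret (\<Gamma> \<otimes> jj K A) A (Pr2 K \<Gamma> (jj K A)))
      (act Q B (prod_map K (Pr1 K \<Gamma> (jj K A)) (Id K (jj K A))) N) = N"
    if \<Gamma>: "\<Gamma> \<in> Ob K" and A: "A \<in> XX K" and B: "B \<in> YY K" and N: "N \<in> car Q (\<Gamma> \<otimes> jj K A) B" for \<Gamma> A B N
  proof -
    note pr = Pr1_arrows[OF \<Gamma> jj_Ob[OF A]] Pr2_arrows[OF \<Gamma> jj_Ob[OF A]]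
    note s = prod_map(1)[OF pr(1) Id_arrows[OF jj_Ob[OF A]]]
    \<comment> \<open>The law \<open>ret_seq\<close> at \<open>V = \<pi>'\<close> gives the action
      of \<open>\<langle>id, \<pi>'\<rangle>\<close> on the weakened \<open>N\<close>, which cancels
      the weakening.\<close>
    show ?thesis
      using ret_seq[OF A B pr(2) act_closed[OF s N]] act_Cmp[OF pairing_Id(1)[OF pr(2)] s N]
        pairing_Id_Pr2[OF \<Gamma> jj_Ob[OF A]] act_Id[OF N] by simp
  qed
  ultimately show ?thesis
    unfolding monoids_bimod_iff mult_seq_retseq_mult[OF assms]
    using bimodule_axioms by (simp add: retseq_unit_apply seq_ret seq_seq)
qed

section \<open>The two assignments are mutually inverse\<close>

lemma retseq_mult_mult_seq:
  assumes "m \<in> multimaps K Tight Tight [Q, Q] Q"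
  shows "retseq_mult K Q (mult_seq m) = m"
  unfolding retseq_mult_def using assms
  by (rule mrestrict_eqI) (auto simp: multimap_dom_explicit length_Suc_conv mult_seq_def)

lemma retseq_unit_unit_ret:
  assumes "bimodule K Q" "e \<in> multimaps K Loose Loose [] Q"
  shows "retseq_unit K Q (unit_ret K Q e) = e"
proof -
  have *: "unit_ret K Q e (\<Gamma> \<otimes> jj K A) A (Pr2 K \<Gamma> (jj K A)) = e \<Gamma> [Mid A] []"
    if A: "A \<in> XX K" and \<Gamma>: "\<Gamma> \<in> Ob K" for \<Gamma> A
  proof -
    note Ob = \<Gamma> jj_Ob[OF A]
    note pr = Pr1_arrows[OF Ob] Pr2_arrows[OF Ob]
    \<comment> \<open>The second fact is naturality along \<pi>; the graph of \<pi>' then undoes the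
      weakening.\<close>
    have e: "e \<Gamma> [Mid A] [] \<in> car Q (\<Gamma> \<otimes> jj K A) (FF K A)"
      "e (\<Gamma> \<otimes> jj K A) [Mid A] [] = act Q (FF K A) (prod_map K (Pr1 K \<Gamma> (jj K A)) (Id K (jj K A))) (e \<Gamma> [Mid A] [])"
      using assms(2) \<Gamma> A pr(1) unfolding multimaps_unit_iff by blast+
    show ?thesis
      using bimodule.act_Cmp[OF assms(1) pairing_Id(1)[OF pr(2)] prod_map(1)[OF pr(1) Id_arrows[OF Ob(2)]] e(1)]
        e(2) A pr(2) pairing_Id_Pr2[OF Ob] bimodule.act_Id[OF assms(1) e(1)] by (simp add: unit_ret_def)
  qed
  show ?thesis
    unfolding retseq_unit_def using assms(2)
    by (rule mrestrict_eqI) (auto simp: multimap_dom_explicit length_Suc_conv *)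
qed

lemma bij_betw_retseq_to_monoid:
  "bij_betw (retseq_to_monoid K) (retseq_models K) (monoids (bimod_multicat K))"
proof (rule bij_betw_byWitness[where f' = "\<lambda>(Q, m, e). (Q, unit_ret K Q e, mult_seq m)"])
  show "\<forall>a\<in>retseq_models K. (\<lambda>(Q, m, e). (Q, unit_ret K Q e, mult_seq m)) (retseq_to_monoid K a) = a"
    by (auto simp: retseq_models_def retseq_to_monoid_def mult_seq_retseq_mult unit_ret_retseq_unit)
  show "\<forall>a\<in>monoids (bimod_multicat K). retseq_to_monoid K ((\<lambda>(Q, m, e). (Q, unit_ret K Q e, mult_seq m)) a) = a"
    by (auto simp: monoids_bimod_iff retseq_to_monoid_def retseq_mult_mult_seq retseq_unit_unit_ret)
  show "retseq_to_monoid K ` retseq_models K \<subseteq> monoids (bimod_multicat K)"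
    by (auto simp: retseq_models_def retseq_to_monoid_def retseq_model_monoid)
  show "(\<lambda>(Q, m, e). (Q, unit_ret K Q e, mult_seq m)) ` monoids (bimod_multicat K) \<subseteq> retseq_models K"
    by (auto simp: retseq_models_def monoid_retseq_model)
qed

end

theorem theorem4:
  fixes K :: "('o, 'm, 'x, 'y) base"
    and S :: "(('o, 'm, 'y, 'e) bimodule, ('o, 'x, 'y, 'e) multimap) multicat"
  assumes "cartesian_base K"
    and "S = bimod_multicat K"
  shows "bi_skew_multicategory S \<and>
    bij_betw (retseq_to_monoid K) (retseq_models K) (monoids S)"
proof -
  interpret plain_cartesian_base K using assms(1) by (rule plain_cartesian_base.intro)
  show ?thesis
    using bi_skew_multicategory_bimod bij_betw_retseq_to_monoid assms(2) by simp
qed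

end
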